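(* Let $n\ge 5$. There exist convex origin-symmetric bodies $K$ and $L$ in $\mathbb{S}^n$ (respectively, in $\mathbb{H}^n$) such that $$\mathrm{vol}_{n-1}(K\cap H)\le \mathrm{vol}_{n-1}(L\cap H)$$ for every central totally geodesic hyperplane $H$, but $\mathrm{vol}_n(K)>\mathrm{vol}_n(L)$.
   Context: Both spaces are modelled on the open unit ball $B^n\subset\mathbb{R}^n$ with the metric $ds^2=4\frac{dx_1^2+\cdots+dx_n^2}{(1+\delta|x|^2)^2}$, where $\delta=+1$ for $\mathbb{S}^n$ (an open hemisphere, via stereographic projection) and $\delta=-1$ for $\mathbb{H}^n$ (Poincaré ball). A body is a compact set with non-empty interior; it is convex if for any two of its points the geodesic segment of the metric joining them lies in the body. Origin-symmetric means $K=-K$. Central totally geodesic hyperplanes are $\{x:\langle x,\xi\rangle=0\}\cap B^n$, $\xi\in S^{n-1}$. Volumes are Riemannian volumes of the metric: $\mathrm{vol}_n(K)=2^n\int_K\frac{dx}{(1+\delta|x|^2)^n}$, $\mathrm{vol}_{n-1}(K\cap\xi^\perp)=2^{n-1}\int_{K\cap\xi^\perp}\frac{dx}{(1+\delta|x|^2)^{n-1}}$. *)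

theory Defs
  imports "HOL-Analysis.Analysis"
begin

text \<open>Model: open unit ball with metric 4|dx|^2/(1+d|x|^2)^2, d = 1 (hemisphere) or d = -1 (Poincare ball).\<close>

text \<open>Map to the projective model (gnomonic projection for the sphere, Klein model for
  hyperbolic space); it sends geodesics of the metric to straight line segments.\<close>
definition proj_model :: "real \<Rightarrow> 'a::euclidean_space \<Rightarrow> 'a" where
  "proj_model d x = (2 / (1 - d * (norm x)\<^sup>2)) *\<^sub>R x"

definition geod_segment :: "real \<Rightarrow> 'a::euclidean_space \<Rightarrow> 'a \<Rightarrow> 'a set" where
  "geod_segment d p q =
     {x \<in> ball 0 1. proj_model d x \<in> closed_segment (proj_model d p) (proj_model d q)}"

definition is_body :: "'a::euclidean_space set \<Rightarrow> bool" where
  "is_body K \<longleftrightarrow> K \<subseteq> ball 0 1 \<and> compact K \<and> interior K \<noteq> {}"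

definition geod_convex :: "real \<Rightarrow> 'a::euclidean_space set \<Rightarrow> bool" where
  "geod_convex d K \<longleftrightarrow> (\<forall>p\<in>K. \<forall>q\<in>K. geod_segment d p q \<subseteq> K)"

definition origin_symmetric :: "'a::euclidean_space set \<Rightarrow> bool" where
  "origin_symmetric K \<longleftrightarrow> uminus ` K = K"

text \<open>Riemannian m-volume of a set S in an m-dimensional Euclidean space with
  the conformal metric: 2^m * integral of 1/(1+d|x|^2)^m.\<close>
definition rvol :: "real \<Rightarrow> nat \<Rightarrow> 'a::euclidean_space set \<Rightarrow> real" where
  "rvol d m S = 2 ^ m * integral S (\<lambda>x. 1 / (1 + d * (norm x)\<^sup>2) ^ m)"

text \<open>f is a linear isometry of the (n-1)-dimensional space 'b onto the central
  hyperplane orthogonal to the unit vector xi; the section K \<inter> xi^perp is then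
  identified with f -` K, and its (n-1)-volume is rvol d DIM('b) (f -` K).\<close>
definition hyperplane_param :: "('b::euclidean_space \<Rightarrow> 'a::euclidean_space) \<Rightarrow> 'a \<Rightarrow> bool" where
  "hyperplane_param f xi \<longleftrightarrow> norm xi = 1 \<and> linear f \<and> (\<forall>t. norm (f t) = norm t)
     \<and> range f = {x. x \<bullet> xi = 0}"

end

theory Submission
  imports Defs
begin

text \<open>
  At a small scale both metrics are nearly Euclidean, so it suffices to find a Euclidean counterexample
  with a uniform gap. Write \<open>m = n - 1\<close>. The zonal quartic \<open>g t = 1 - 2 m t^2 + m (m + 2) / 3 t^4\<close>
  has nonnegative integrals over all central sections of the sphere, and its integral against the radial
  function \<open>1 / sqrt (1 - t^2)\<close> of an infinite cylinder vanishes. For \<open>m \<ge> 4\<close> it is positive near the poles,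
  so truncating the cylinder makes the latter integral negative. Subtracting a small multiple of
  (an approximation of) \<open>g\<close> from the \<open>m\<close>-th power of the radial function of a truncated cylinder therefore
  shrinks every central section but enlarges the volume. Both bodies stay convex because a small
  multiple of \<open>|z|\<close> is added to the gauge first and \<open>g\<close> is replaced by a polynomial approximation
  after multiplication with a power of the cylinder profile.
\<close>

section \<open>Lebesgue measure in polar coordinates\<close>

text \<open>At the poles \<open>g\<close> equals (m - 1)(m - 3)/3, which for m \<ge> 2 is positive
  only if m > 3: this is where n \<ge> 5 enters. The section integral of \<open>g\<close> is a
  perfect square that vanishes when the hyperplane contains the axis, so \<open>g\<close> alone
  leaves no gap for the passage to curved metrics; a small positive constant is added to it.

  No Taylor remainder has to be controlled. Let \<nu> be the gauge profile of L and \<mu> = \<nu> +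
  \<epsilon> \<phi> that of K. Since A^(-k) is convex in A, its tangent at \<nu> bounds the volume
  of K from below, and its tangent at \<mu> bounds the sections of L from below. Hence the condition
  on sections has \<mu> in its denominator and the condition on volume has \<nu>.

  Flat sides and edges leave the cylinder no convexity to spare. Both gauges therefore receive the
  term \<delta> |z|; in K it equals (\<delta>/M) M |z|, and for large M the profile \<phi> + M gives
  a convex gauge, provided that \<phi> has a bounded second derivative. The natural direction, a
  power of the cylinder profile times a quartic, has kinks at the edges, hence the
  approximation.\<close>

lemma nn_integral_lborel_scaleR:
  fixes f :: "'a::euclidean_space \<Rightarrow> ennreal"
  assumes [measurable]: "f \<in> borel_measurable borel" and "c \<noteq> 0"
  shows "(\<integral>\<^sup>+x. f x \<partial>lborel) = ennreal (\<bar>c\<bar> ^ DIM('a)) * (\<integral>\<^sup>+x. f (c *\<^sub>R x) \<partial>lborel)"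
  by (subst lborel_affine[OF \<open>c \<noteq> 0\<close>, of 0])
     (simp add: nn_integral_density nn_integral_distr nn_integral_cmult)

lemma nn_integral_lborel_reflect:
  fixes f :: "'a::euclidean_space \<Rightarrow> ennreal"
  assumes [measurable]: "f \<in> borel_measurable borel"
  shows "(\<integral>\<^sup>+x. f (t - x) \<partial>lborel) = (\<integral>\<^sup>+x. f x \<partial>lborel)"
  by (subst (2) lborel_affine[of "-1" t])
     (simp_all add: nn_integral_density nn_integral_distr nn_integral_cmult)

lemma nn_integral_lborel_translate:
  fixes f :: "'a::euclidean_space \<Rightarrow> ennreal"
  assumes [measurable]: "f \<in> borel_measurable borel"
  shows "(\<integral>\<^sup>+x. f (x - t) \<partial>lborel) = (\<integral>\<^sup>+x. f x \<partial>lborel)"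
  by (subst (2) lborel_affine[of "1" "-t"])
     (simp_all add: nn_integral_density nn_integral_distr nn_integral_cmult)

text \<open>The image measure is translation invariant, hence a multiple of Lebesgue measure; the
  unit ball determines the factor. The two evaluations of one double integral below avoid a general
  uniqueness theorem for Haar measure.\<close>
lemma distr_lborel_isometry:
  fixes f :: "'a::euclidean_space \<Rightarrow> 'b::euclidean_space"
  assumes "linear f" and iso: "\<And>x. norm (f x) = norm x" and dim: "DIM('a) = DIM('b)"
  shows "distr lborel borel f = lborel"
proof (rule measure_eqI)
  have [measurable]: "f \<in> borel_measurable borel"
    using \<open>linear f\<close> by (simp add: borel_measurable_continuous_onI linear_continuous_on linear_conv_bounded_linear)
  have "inj f"
    using iso by (metis linear_injective_0[OF \<open>linear f\<close>] norm_eq_zero)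
  then have "surj f"
    using linear_surjective_imp_injective[OF \<open>linear f\<close>] dim
    by (metis \<open>linear f\<close> dim_UNIV dim_eq_full dim_image_eq inj_on_subset span_UNIV span_linear_image subset_UNIV)
  then obtain g where g: "\<And>y. f (g y) = y" by (metis surjD)
  fix A :: "'b set" assume "A \<in> sets (distr lborel borel f)"
  then have [measurable]: "A \<in> sets borel" by simp
  let ?B = "ball 0 1 :: 'b set"
  define \<beta> where "\<beta> = emeasure lborel ?B"
  have [measurable]: "?B \<in> sets borel" by simp
  have \<beta>: "\<beta> \<noteq> 0" "\<beta> \<noteq> \<infinity>"
    by (simp_all add: \<beta>_def emeasure_ball less_imp_neq[THEN not_sym])
  have vol_preimage_ball: "(\<integral>\<^sup>+u. indicator ?B (f u) \<partial>lborel) = \<beta>"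
  proof -
    have "(\<integral>\<^sup>+u. indicator ?B (f u) \<partial>lborel) = (\<integral>\<^sup>+u. indicator (ball 0 1) (u::'a) \<partial>lborel)"
      by (rule nn_integral_cong) (simp add: indicator_def iso)
    then show ?thesis by (simp add: \<beta>_def emeasure_ball dim)
  qed
  have "\<beta> * emeasure lborel A = (\<integral>\<^sup>+x. indicator A x * (\<integral>\<^sup>+u. indicator ?B (f u - x) \<partial>lborel) \<partial>lborel)"
  proof -
    have "(\<integral>\<^sup>+u. indicator ?B (f u - x) \<partial>lborel) = \<beta>" for x
    proof -
      have "(\<integral>\<^sup>+u. indicator ?B (f u - x) \<partial>lborel) = (\<integral>\<^sup>+u. indicator ?B (f (u - g x)) \<partial>lborel)"
        by (simp add: linear_diff[OF \<open>linear f\<close>] g)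
      also have "\<dots> = (\<integral>\<^sup>+u. indicator ?B (f u) \<partial>lborel)"
        by (rule nn_integral_lborel_translate) measurable
      finally show ?thesis by (simp add: vol_preimage_ball)
    qed
    then show ?thesis by (simp add: mult.commute[of "indicator A _"] nn_integral_cmult_indicator)
  qed
  also have "\<dots> = (\<integral>\<^sup>+x. (\<integral>\<^sup>+u. indicator A x * indicator ?B (f u - x) \<partial>lborel) \<partial>lborel)"
    by (intro nn_integral_cong nn_integral_cmult[symmetric]) measurable
  also have "\<dots> = (\<integral>\<^sup>+u. (\<integral>\<^sup>+x. indicator A x * indicator ?B (f u - x) \<partial>lborel) \<partial>lborel)"
    by (rule lborel_pair.Fubini') measurable
  \<comment> \<open>The substitution x \<mapsto> f u - x exchanges the roles of \<open>A\<close> and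
    the ball, so that the integral over u now measures the preimage of \<open>A\<close>.\<close>
  also have "\<dots> = (\<integral>\<^sup>+u. (\<integral>\<^sup>+x. indicator A (f u - x) * indicator ?B x \<partial>lborel) \<partial>lborel)"
  proof (rule nn_integral_cong)
    fix u
    show "(\<integral>\<^sup>+x. indicator A x * indicator ?B (f u - x) \<partial>lborel) = (\<integral>\<^sup>+x. indicator A (f u - x) * indicator ?B x \<partial>lborel)"
      using nn_integral_lborel_reflect[of "\<lambda>x. indicator A x * indicator ?B (f u - x)" "f u"] by simp
  qed
  also have "\<dots> = (\<integral>\<^sup>+x. (\<integral>\<^sup>+u. indicator A (f u - x) * indicator ?B x \<partial>lborel) \<partial>lborel)"
    by (rule lborel_pair.Fubini') measurable
  also have "\<dots> = (\<integral>\<^sup>+x. indicator ?B x * (\<integral>\<^sup>+u. indicator A (f u) \<partial>lborel) \<partial>lborel)"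
  proof (rule nn_integral_cong)
    fix x
    have "(\<integral>\<^sup>+u. indicator A (f u - x) * indicator ?B x \<partial>lborel) =
        (\<integral>\<^sup>+u. indicator A (f u - x) \<partial>lborel) * indicator ?B x"
      by (rule nn_integral_multc) measurable
    also have "(\<integral>\<^sup>+u. indicator A (f u - x) \<partial>lborel) = (\<integral>\<^sup>+u. indicator A (f (u - g x)) \<partial>lborel)"
      by (simp add: linear_diff[OF \<open>linear f\<close>] g)
    also have "\<dots> = (\<integral>\<^sup>+u. indicator A (f u) \<partial>lborel)"
      by (rule nn_integral_lborel_translate) measurable
    finally show "(\<integral>\<^sup>+u. indicator A (f u - x) * indicator ?B x \<partial>lborel) =
        indicator ?B x * (\<integral>\<^sup>+u. indicator A (f u) \<partial>lborel)"
      by (simp add: mult.commute)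
  qed
  also have "\<dots> = \<beta> * (\<integral>\<^sup>+u. indicator A (f u) \<partial>lborel)"
    by (subst nn_integral_multc) (simp_all add: \<beta>_def)
  also have "(\<integral>\<^sup>+u. indicator A (f u) \<partial>lborel) = emeasure (distr lborel borel f) A"
    by (simp add: nn_integral_distr flip: nn_integral_indicator)
  finally show "emeasure (distr lborel borel f) A = emeasure lborel A"
    using \<beta> by (simp add: ennreal_mult_cancel_left)
qed simp

lemma nn_integral_power_Ioc:
  assumes "0 < k" "0 \<le> r"
  shows "(\<integral>\<^sup>+s. ennreal (real k * s ^ (k - 1)) * indicator {0<..r} s \<partial>lborel) = ennreal (r ^ k)"
proof -
  have "(\<integral>\<^sup>+s. ennreal (real k * s ^ (k - 1)) * indicator {0<..r} s \<partial>lborel)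
      = (\<integral>\<^sup>+s. ennreal (real k * s ^ (k - 1)) * indicator {0..r} s \<partial>lborel)"
    by (rule nn_integral_cong_AE)
       (use AE_lborel_singleton[of "0::real"] in \<open>eventually_elim, auto simp: indicator_def\<close>)
  also have "\<dots> = r ^ k - 0 ^ k"
    using assms by (intro nn_integral_FTC_Icc) (auto intro!: derivative_eq_intros)
  finally show ?thesis using assms by (simp add: power_0_left)
qed

lemma nn_integral_inverse_power_Ici:
  assumes "0 < k" "0 < r"
  shows "(\<integral>\<^sup>+s. ennreal (real k * r ^ k / s ^ (k + 1)) * indicator {r..} s \<partial>lborel) = 1"
proof -
  have lim: "((\<lambda>s. - (r ^ k / s ^ k)) \<longlongrightarrow> - 0) at_top"
    using assms by (intro tendsto_intros tendsto_divide_0[OF tendsto_const] filterlim_at_top_imp_at_infinity filterlim_pow_at_top filterlim_ident)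
  have "(\<integral>\<^sup>+s. ennreal (real k * r ^ k / s ^ (k + 1)) * indicator {r..} s \<partial>lborel)
      = ennreal (- 0 - - (r ^ k / r ^ k))"
  proof (rule nn_integral_FTC_atLeast[OF _ _ _ lim])
    fix x assume "r \<le> x"
    with assms have "x > 0" by simp
    moreover have "x ^ k * x ^ k = x ^ (k - 1) * x ^ (k + 1)"
      using \<open>0 < k\<close> by (cases k) (simp_all add: algebra_simps)
    ultimately show "((\<lambda>s. - (r ^ k / s ^ k)) has_real_derivative real k * r ^ k / x ^ (k + 1)) (at x)"
      by (auto intro!: derivative_eq_intros simp: field_simps)
    show "0 \<le> real k * r ^ k / x ^ (k + 1)" using assms \<open>x > 0\<close> by simp
  qed simp_all
  then show ?thesis using assms by simp
qed

text \<open>Integration in polar coordinates, with the unit ball in place of the sphere: insert the factor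
  \<open>\<integral> m |z|^m / s^(m+1) ds = 1\<close> (over \<open>s \<ge> |z|\<close>), substitute \<open>z = s w\<close> and integrate over \<open>s\<close> first.\<close>
lemma emeasure_gauge_le_1:
  fixes N :: "'a::euclidean_space \<Rightarrow> real"
  assumes [measurable]: "N \<in> borel_measurable borel"
    and hom: "\<And>c x. c > 0 \<Longrightarrow> N (c *\<^sub>R x) = c * N x"
    and pos: "\<And>x. x \<noteq> 0 \<Longrightarrow> N x > 0"
  shows "emeasure lborel {x. N x \<le> 1} = (\<integral>\<^sup>+x. ennreal ((norm x / N x) ^ DIM('a)) * indicator (cball 0 1) x \<partial>lborel)"
proof -
  let ?m = "DIM('a)"
  define F where "F = (\<lambda>(z::'a) s. if N z \<le> 1 \<and> norm z \<le> s \<and> 0 < s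
    then ennreal (real ?m * norm z ^ ?m / s ^ (?m + 1)) else 0)"
  \<comment> \<open>This is s^m F (s w) s, the integrand after z = s w with its Jacobian. The
    condition |z| \<le> s has become |w| \<le> 1, and N z \<le> 1 has become s \<le> 1 / N w, so the
    integral over s produces (1 / N w)^m.\<close>
  define G where "G = (\<lambda>(w::'a) s. if norm w \<le> 1 \<and> 0 < s \<and> s * N w \<le> 1
    then ennreal (norm w ^ ?m * (real ?m * s ^ (?m - 1))) else 0)"
  have [measurable]: "case_prod F \<in> borel_measurable (lborel \<Otimes>\<^sub>M lborel)"
    "case_prod G \<in> borel_measurable (lborel \<Otimes>\<^sub>M lborel)"
    unfolding F_def G_def by measurable
  have [measurable]: "(\<lambda>z. F z s) \<in> borel_measurable borel" for s
    unfolding F_def by measurable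
  have "emeasure lborel {x. N x \<le> 1} = (\<integral>\<^sup>+z. indicator {x. N x \<le> 1} z \<partial>lborel)"
    by simp
  also have "\<dots> = (\<integral>\<^sup>+z. (\<integral>\<^sup>+s. F z s \<partial>lborel) \<partial>lborel)"
  proof (rule nn_integral_cong_AE)
    show "AE z in lborel. indicator {x. N x \<le> 1} z = (\<integral>\<^sup>+s. F z s \<partial>lborel)"
      using AE_lborel_singleton[of "0::'a"]
    proof eventually_elim
      fix z :: 'a assume "z \<noteq> 0"
      then have "s > 0" if "norm z \<le> s" for s
        using that by (meson order_less_le_trans zero_less_norm_iff)
      then have "F z s = ennreal (real ?m * norm z ^ ?m / s ^ (?m + 1)) * indicator {norm z..} s"
        if "N z \<le> 1" for s
        using that by (auto simp: F_def)
      moreover have "F z s = 0" if "\<not> N z \<le> 1" for s using that by (simp add: F_def)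
      ultimately show "indicator {x. N x \<le> 1} z = (\<integral>\<^sup>+s. F z s \<partial>lborel)"
        using \<open>z \<noteq> 0\<close> nn_integral_inverse_power_Ici[of ?m "norm z"]
        by (cases "N z \<le> 1") (simp_all del: power_Suc add_uminus_conv_diff)
    qed
  qed
  also have "\<dots> = (\<integral>\<^sup>+s. (\<integral>\<^sup>+z. F z s \<partial>lborel) \<partial>lborel)"
    by (rule lborel_pair.Fubini'[symmetric]) measurable
  also have "\<dots> = (\<integral>\<^sup>+s. (\<integral>\<^sup>+w. G w s \<partial>lborel) \<partial>lborel)"
  proof (rule nn_integral_cong)
    fix s :: real
    show "(\<integral>\<^sup>+z. F z s \<partial>lborel) = (\<integral>\<^sup>+w. G w s \<partial>lborel)"
    proof (cases "s > 0")
      case True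
      have "(\<integral>\<^sup>+z. F z s \<partial>lborel) = ennreal (\<bar>s\<bar> ^ ?m) * (\<integral>\<^sup>+z. F (s *\<^sub>R z) s \<partial>lborel)"
        using True by (intro nn_integral_lborel_scaleR) simp_all
      also have "\<dots> = (\<integral>\<^sup>+z. ennreal (\<bar>s\<bar> ^ ?m) * F (s *\<^sub>R z) s \<partial>lborel)"
        by (intro nn_integral_cmult[symmetric]) measurable
      also have "\<dots> = (\<integral>\<^sup>+w. G w s \<partial>lborel)"
      proof (rule nn_integral_cong)
        fix w :: 'a
        have pw: "s ^ ?m = s * s ^ (?m - 1)" by (simp flip: power_Suc)
        have e: "\<bar>s\<bar> ^ ?m * (real ?m * norm (s *\<^sub>R w) ^ ?m / s ^ (?m + 1)) = norm w ^ ?m * (real ?m * s ^ (?m - 1))"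
          using True by (simp add: power_mult_distrib field_simps) (simp add: pw)
        have "norm (s *\<^sub>R w) \<le> s \<longleftrightarrow> norm w \<le> 1" using True by simp
        then show "ennreal (\<bar>s\<bar> ^ ?m) * F (s *\<^sub>R w) s = G w s"
          unfolding F_def G_def using True e
          by (auto simp: hom simp del: norm_scaleR power_Suc simp flip: ennreal_mult)
      qed
      finally show ?thesis .
    qed (simp add: F_def G_def)
  qed
  also have "\<dots> = (\<integral>\<^sup>+w. (\<integral>\<^sup>+s. G w s \<partial>lborel) \<partial>lborel)"
    by (rule lborel_pair.Fubini') measurable
  also have "\<dots> = (\<integral>\<^sup>+x. ennreal ((norm x / N x) ^ DIM('a)) * indicator (cball 0 1) x \<partial>lborel)"
  proof (rule nn_integral_cong_AE)
    show "AE w in lborel. (\<integral>\<^sup>+s. G w s \<partial>lborel) =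
        ennreal ((norm w / N w) ^ DIM('a)) * indicator (cball 0 1) w"
      using AE_lborel_singleton[of "0::'a"]
    proof eventually_elim
      fix w :: 'a assume "w \<noteq> 0"
      then have "N w > 0" by (rule pos)
      have "(\<integral>\<^sup>+s. G w s \<partial>lborel) = (\<integral>\<^sup>+s. (ennreal (norm w ^ ?m) * indicator (cball 0 1) w) *
          (ennreal (real ?m * s ^ (?m - 1)) * indicator {0<..1 / N w} s) \<partial>lborel)"
        using \<open>N w > 0\<close> by (intro nn_integral_cong) (auto simp: G_def indicator_def field_simps ennreal_mult)
      also have "\<dots> = (ennreal (norm w ^ ?m) * indicator (cball 0 1) w) * ennreal ((1 / N w) ^ ?m)"
        using \<open>N w > 0\<close> nn_integral_power_Ioc[of ?m "1 / N w"] by (subst nn_integral_cmult) auto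
      also have "\<dots> = ennreal ((norm w / N w) ^ DIM('a)) * indicator (cball 0 1) w"
        using \<open>N w > 0\<close> by (simp add: power_divide mult.commute mult.left_commute indicator_def flip: ennreal_mult)
      finally show "(\<integral>\<^sup>+s. G w s \<partial>lborel) = ennreal ((norm w / N w) ^ DIM('a)) * indicator (cball 0 1) w" .
    qed
  qed
  finally show ?thesis .
qed

section \<open>Moments of the unit ball\<close>

lemma sets_borel_cball [measurable]: "cball a r \<in> sets borel"
  by simp

text \<open>The reflection in the hyperplane orthogonal to u - v works, since u and v have equal
  norm.\<close>

lemma exists_linear_isometry_maps_to:
  fixes u v :: "'a::euclidean_space"
  assumes "norm u = norm v"
  obtains f :: "'a \<Rightarrow> 'a" where "linear f" "\<And>x y. f x \<bullet> f y = x \<bullet> y" "f u = v"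
proof (cases "u = v")
  case True
  then show ?thesis by (intro that[of "\<lambda>x. x"]) (auto simp: linear_id[unfolded id_def])
next
  case False
  define d where "d = u - v"
  have "d \<bullet> d \<noteq> 0" using False by (simp add: d_def)
  define f where "f = (\<lambda>x. x - (2 * (x \<bullet> d) / (d \<bullet> d)) *\<^sub>R d)"
  have "u \<bullet> u = v \<bullet> v" using assms by (simp add: norm_eq)
  then have "2 * (u \<bullet> d) = d \<bullet> d" by (simp add: d_def inner_diff inner_commute)
  with \<open>d \<bullet> d \<noteq> 0\<close> have "f u = v" by (simp add: f_def) (simp add: d_def)
  moreover have "linear f"
    by (rule linearI) (simp_all add: f_def inner_add_left algebra_simps add_divide_distrib)
  moreover have "f x \<bullet> f y = x \<bullet> y" for x y
    using \<open>d \<bullet> d \<noteq> 0\<close> by (simp add: f_def inner_diff inner_commute field_simps)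
  ultimately show ?thesis using that by blast
qed

lemma integrable_cball_bounded:
  fixes h :: "'a::euclidean_space \<Rightarrow> real"
  assumes [measurable]: "h \<in> borel_measurable borel" and "\<And>x. \<bar>h x\<bar> \<le> C"
  shows "integrable lborel (\<lambda>x. h x * indicator (cball 0 1) x)"
proof (rule Bochner_Integration.integrable_bound)
  show "(\<lambda>x. h x * indicator (cball 0 1) x) \<in> borel_measurable lborel" by measurable
  show "integrable lborel (\<lambda>x. C * indicator (cball (0::'a) 1) x)"
    by (intro integrable_mult_right integrable_real_indicator) (auto simp: emeasure_cball)
  show "AE x in lborel. norm (h x * indicator (cball 0 1) x) \<le> norm (C * indicator (cball 0 1) x)"
    using order_trans[OF assms(2) abs_ge_self] by (auto simp: indicator_def intro!: AE_I2)
qed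

text \<open>The integrand depends only on the direction of t, so up to a constant this is a moment
  of the unit sphere; integrating over the ball needs no surface measure. For k = 0 it is the volume
  of the ball.\<close>

definition ball_moment :: "nat \<Rightarrow> 'a::euclidean_space \<Rightarrow> real" where
  "ball_moment k w = (\<integral>t. ((t \<bullet> w) / norm t) ^ k * indicator (cball 0 1) t \<partial>lborel)"

lemma abs_inner_div_norm_le: "\<bar>(t \<bullet> w) / norm t\<bar> \<le> norm w" for t w :: "'a::euclidean_space"
  using Cauchy_Schwarz_ineq2[of t w] by (cases "t = 0") (auto simp: field_simps)

lemma integrable_ball_moment:
  "integrable lborel (\<lambda>t. ((t \<bullet> w) / norm t) ^ k * indicator (cball 0 1) t)" for w :: "'a::euclidean_space"
  by (rule integrable_cball_bounded[where C = "norm w ^ k"])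
     (measurable, unfold power_abs, intro power_mono abs_inner_div_norm_le abs_ge_zero)

lemma ball_moment_norm_eq:
  fixes w w' :: "'a::euclidean_space"
  assumes "norm w = norm w'"
  shows "ball_moment k w = ball_moment k w'"
proof -
  obtain f :: "'a \<Rightarrow> 'a" where f: "linear f" "\<And>x y. f x \<bullet> f y = x \<bullet> y" "f w = w'"
    using exists_linear_isometry_maps_to[OF assms] by blast
  have nf: "norm (f t) = norm t" for t by (simp add: norm_eq_sqrt_inner f)
  have [measurable]: "f \<in> borel_measurable borel"
    using \<open>linear f\<close> by (simp add: borel_measurable_continuous_onI linear_continuous_on linear_conv_bounded_linear)
  have "ball_moment k w' = (\<integral>t. ((t \<bullet> w') / norm t) ^ k * indicator (cball 0 1) t \<partial>distr lborel borel f)"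
    by (simp add: ball_moment_def distr_lborel_isometry[OF f(1) nf])
  also have "\<dots> = (\<integral>t. ((f t \<bullet> w') / norm (f t)) ^ k * indicator (cball 0 1) (f t) \<partial>lborel)"
    by (rule integral_distr) measurable
  also have "\<dots> = ball_moment k w"
    unfolding ball_moment_def by (simp add: nf f(2) indicator_def flip: f(3))
  finally show ?thesis ..
qed

lemma ball_moment_scaleR: "ball_moment k (c *\<^sub>R w) = c ^ k * ball_moment k w"
  unfolding ball_moment_def by (simp add: power_mult_distrib power_divide flip: integral_mult_right_zero)
    (simp add: mult.assoc)

lemma ball_moment_eq:
  fixes w e :: "'a::euclidean_space"
  assumes "norm e = 1" "k \<noteq> 0"
  shows "ball_moment k w = norm w ^ k * ball_moment k e"
  using ball_moment_norm_eq[of w "norm w *\<^sub>R e" k] assms by (simp add: ball_moment_scaleR)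

text \<open>By rotation invariance all basis vectors have the same moment, and the squared direction
  cosines add up to 1.\<close>

lemma ball_moment_2:
  "real DIM('a) * ball_moment 2 (w::'a::euclidean_space) = (norm w)\<^sup>2 * measure lborel (cball (0::'a) 1)"
proof -
  define V where "V = measure lborel (cball (0::'a) 1)"
  obtain e :: 'a where e: "e \<in> Basis" using nonempty_Basis by blast
  have "real DIM('a) * ball_moment 2 e = (\<Sum>i\<in>Basis. ball_moment 2 (i::'a))"
  proof -
    have "ball_moment 2 i = ball_moment 2 e" if "i \<in> Basis" for i :: 'a
      by (rule ball_moment_norm_eq) (simp add: that e)
    then show ?thesis by simp
  qed
  also have "\<dots> = (\<integral>t. (\<Sum>i\<in>Basis. ((t \<bullet> i) / norm t)\<^sup>2 * indicator (cball 0 1) t) \<partial>(lborel::'a measure))"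
    unfolding ball_moment_def by (intro Bochner_Integration.integral_sum[symmetric] integrable_ball_moment)
  also have "\<dots> = (\<integral>t. indicator (cball 0 1) t \<partial>(lborel::'a measure))"
  proof (rule integral_cong_AE)
    show "AE t in lborel. (\<Sum>i\<in>Basis. ((t \<bullet> i) / norm t)\<^sup>2 * indicator (cball 0 1) t) = indicator (cball (0::'a) 1) t"
      using AE_lborel_singleton[of "0::'a"]
    proof eventually_elim
      fix t :: 'a assume "t \<noteq> 0"
      have "(\<Sum>i\<in>Basis. (t \<bullet> i)\<^sup>2) = (norm t)\<^sup>2"
        unfolding power2_norm_eq_inner by (subst euclidean_inner) (simp add: power2_eq_square)
      then have "(\<Sum>i\<in>Basis. ((t \<bullet> i) / norm t)\<^sup>2) = 1"
        using \<open>t \<noteq> 0\<close> by (simp add: power_divide flip: sum_divide_distrib)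
      then show "(\<Sum>i\<in>Basis. ((t \<bullet> i) / norm t)\<^sup>2 * indicator (cball 0 1) t) = indicator (cball (0::'a) 1) t"
        by (simp flip: sum_distrib_right)
    qed
  qed measurable
  finally have "real DIM('a) * ball_moment 2 e = V" by (simp add: V_def)
  moreover have "ball_moment 2 w = (norm w)\<^sup>2 * ball_moment 2 e"
    using e by (intro ball_moment_eq) auto
  ultimately show ?thesis by (simp add: V_def)
qed

text \<open>The moment is \<open>c |w|^4\<close>; evaluating \<open>\<Sum>\<^sub>i\<^sub>j (t\<^sub>i + t\<^sub>j)^4 + (t\<^sub>i - t\<^sub>j)^4\<close> in two ways determines \<open>c\<close>.\<close>
lemma ball_moment_4:
  "real DIM('a) * (real DIM('a) + 2) * ball_moment 4 (w::'a::euclidean_space) =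
    3 * norm w ^ 4 * measure lborel (cball (0::'a) 1)"
proof -
  define V where "V = measure lborel (cball (0::'a) 1)"
  obtain e :: 'a where e: "e \<in> Basis" using nonempty_Basis by blast
  let ?m = "real DIM('a)"
  define c where "c = ball_moment 4 e"
  have c: "ball_moment 4 u = (u \<bullet> u)\<^sup>2 * c" for u :: 'a
  proof -
    have "norm u ^ 4 = (u \<bullet> u)\<^sup>2" by (simp add: dot_square_norm)
    then show ?thesis using e unfolding c_def by (subst ball_moment_eq[of e]) auto
  qed
  have basis_sum: "(\<Sum>i\<in>Basis. \<Sum>j\<in>Basis. (i \<bullet> (j::'a))\<^sup>2) = ?m"
  proof -
    have "(\<Sum>j\<in>Basis. (i \<bullet> (j::'a))\<^sup>2) = 1" if "i \<in> Basis" for i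
    proof -
      have "(\<Sum>j\<in>Basis. (i \<bullet> (j::'a))\<^sup>2) = (\<Sum>j\<in>Basis. if j = i then 1 else 0)"
        using that by (intro sum.cong) (auto simp: inner_Basis)
      then show ?thesis using that by simp
    qed
    then show ?thesis by simp
  qed
  have "(\<Sum>i\<in>Basis. \<Sum>j\<in>Basis. ball_moment 4 (i + (j::'a)) + ball_moment 4 (i - j)) =
      (\<Sum>i\<in>Basis. \<Sum>j\<in>Basis. 8 * c + 8 * c * (i \<bullet> (j::'a))\<^sup>2)"
  proof (intro sum.cong refl)
    fix i j :: 'a assume "i \<in> Basis" "j \<in> Basis"
    then have 1: "(i + j) \<bullet> (i + j) = 2 + 2 * (i \<bullet> j)" and 2: "(i - j) \<bullet> (i - j) = 2 - 2 * (i \<bullet> j)"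
      by (simp_all add: inner_add inner_diff inner_commute)
    then show "ball_moment 4 (i + j) + ball_moment 4 (i - j) = 8 * c + 8 * c * (i \<bullet> j)\<^sup>2"
      unfolding c 1 2 by algebra
  qed
  also have "\<dots> = 8 * c * ?m\<^sup>2 + 8 * c * ?m"
    by (simp add: sum.distrib basis_sum flip: sum_distrib_left) (simp add: power2_eq_square)
  finally have lhs: "(\<Sum>i\<in>Basis. \<Sum>j\<in>Basis. ball_moment 4 (i + (j::'a)) + ball_moment 4 (i - j)) = 8 * c * ?m\<^sup>2 + 8 * c * ?m" .
  define T where "T = (\<lambda>i t::'a. (t \<bullet> i) / norm t)"
  define I where "I = (\<lambda>t::'a. indicator (cball 0 1) t :: real)"
  have int: "integrable lborel (\<lambda>t. ((t \<bullet> u) / norm t) ^ 4 * I t)" for u :: 'a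
    unfolding I_def by (rule integrable_ball_moment)
  have "(\<Sum>i\<in>Basis. \<Sum>j\<in>Basis. ball_moment 4 (i + (j::'a)) + ball_moment 4 (i - j)) =
      (\<integral>t. (\<Sum>i\<in>Basis. \<Sum>j\<in>Basis. ((t \<bullet> (i + j)) / norm t) ^ 4 * I t + ((t \<bullet> (i - j)) / norm t) ^ 4 * I t) \<partial>lborel)"
    unfolding ball_moment_def I_def[symmetric]
    by (simp add: int)
  also have "\<dots> = (\<integral>t. 4 * ?m * (\<Sum>i\<in>Basis. T i t ^ 4 * I t) + 12 * I t \<partial>lborel)"
  proof (rule integral_cong_AE)
    show "AE t in lborel. (\<Sum>i\<in>Basis. \<Sum>j\<in>Basis. ((t \<bullet> (i + j)) / norm t) ^ 4 * I t + ((t \<bullet> (i - j)) / norm t) ^ 4 * I t) =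
        4 * ?m * (\<Sum>i\<in>Basis. T i t ^ 4 * I t) + 12 * I t"
      using AE_lborel_singleton[of "0::'a"]
    proof eventually_elim
      fix t :: 'a assume "t \<noteq> 0"
      have "(\<Sum>i\<in>Basis. (t \<bullet> i)\<^sup>2) = (norm t)\<^sup>2"
        unfolding power2_norm_eq_inner by (subst euclidean_inner) (simp add: power2_eq_square)
      then have T2: "(\<Sum>i\<in>Basis. (T i t)\<^sup>2) = 1"
        using \<open>t \<noteq> 0\<close> by (simp add: T_def power_divide flip: sum_divide_distrib)
      \<comment> \<open>Adding the term with i - j cancels the odd mixed products. The remaining
        products of squares sum over i and j to the square of the sum of
        \<open>(T i t)\<^sup>2\<close>, which is 1.\<close>
      have "((t \<bullet> (i + j)) / norm t) ^ 4 * I t + ((t \<bullet> (i - j)) / norm t) ^ 4 * I t =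
          (2 * T i t ^ 4 + 2 * T j t ^ 4 + 12 * ((T i t)\<^sup>2 * (T j t)\<^sup>2)) * I t" for i j
      proof -
        have 1: "(t \<bullet> (i + j)) / norm t = T i t + T j t" and 2: "(t \<bullet> (i - j)) / norm t = T i t - T j t"
          by (simp_all add: T_def inner_add inner_diff add_divide_distrib diff_divide_distrib)
        show ?thesis unfolding 1 2 by algebra
      qed
      then have "(\<Sum>i\<in>Basis. \<Sum>j\<in>Basis. ((t \<bullet> (i + j)) / norm t) ^ 4 * I t + ((t \<bullet> (i - j)) / norm t) ^ 4 * I t) =
         (\<Sum>i\<in>Basis. \<Sum>j\<in>Basis. 2 * T i t ^ 4 + 2 * T j t ^ 4 + 12 * ((T i t)\<^sup>2 * (T j t)\<^sup>2)) * I t"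
        by (simp add: sum_distrib_right)
      also have "(\<Sum>i\<in>Basis. \<Sum>j\<in>Basis. 2 * T i t ^ 4 + 2 * T j t ^ 4 + 12 * ((T i t)\<^sup>2 * (T j t)\<^sup>2)) =
          4 * ?m * (\<Sum>i\<in>Basis. T i t ^ 4) + 12 * ((\<Sum>i\<in>Basis. (T i t)\<^sup>2) * (\<Sum>i\<in>Basis. (T i t)\<^sup>2))"
        unfolding sum_product by (simp add: sum.distrib flip: sum_distrib_left)
      finally show "(\<Sum>i\<in>Basis. \<Sum>j\<in>Basis. ((t \<bullet> (i + j)) / norm t) ^ 4 * I t + ((t \<bullet> (i - j)) / norm t) ^ 4 * I t) =
        4 * ?m * (\<Sum>i\<in>Basis. T i t ^ 4 * I t) + 12 * I t"
        by (simp add: T2 flip: sum_distrib_right) (simp add: algebra_simps)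
    qed
  qed (unfold I_def T_def, measurable)
  also have "\<dots> = 4 * ?m * (\<Sum>i\<in>Basis. ball_moment 4 (i::'a)) + 12 * V"
  proof -
    have "integrable lborel I" "(\<integral>t. I t \<partial>lborel) = V"
      unfolding I_def V_def using integrable_ball_moment[where w = "0::'a" and k = 0] by simp_all
    then show ?thesis
      unfolding ball_moment_def I_def[symmetric] T_def
      by (subst Bochner_Integration.integral_add) (auto intro!: int Bochner_Integration.integrable_sum integrable_mult_right simp: Bochner_Integration.integral_sum int)
  qed
  also have "(\<Sum>i\<in>Basis. ball_moment 4 (i::'a)) = ?m * c" by (simp add: c)
  finally have "8 * c * ?m\<^sup>2 + 8 * c * ?m = 4 * ?m\<^sup>2 * c + 12 * V" using lhs by (simp add: power2_eq_square)
  then have "?m * (?m + 2) * c = 3 * V" by (simp add: power2_eq_square algebra_simps)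
  then have "(w \<bullet> w)\<^sup>2 * (?m * (?m + 2) * c) = (w \<bullet> w)\<^sup>2 * (3 * V)" by simp
  then show ?thesis by (simp add: c dot_square_norm mult_ac V_def)
qed


text \<open>The coefficients of the quartic are the ones that turn the moments |w|^2/m and
  3|w|^4/(m(m + 2)) into 1 - 2|w|^2 + |w|^4, a square.\<close>

lemma ball_integral_quartic:
  fixes w :: "'a::euclidean_space"
  defines "m \<equiv> real DIM('a)"
  shows "(\<integral>t. (1 - 2 * m * ((t \<bullet> w) / norm t)\<^sup>2 + m * (m + 2) / 3 * ((t \<bullet> w) / norm t) ^ 4) *
      indicator (cball 0 1) t \<partial>lborel) = measure lborel (cball (0::'a) 1) * (1 - (norm w)\<^sup>2)\<^sup>2"
proof -
  let ?I = "\<lambda>t::'a. indicator (cball 0 1) t :: real"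
  have int: "integrable lborel (\<lambda>t. ((t \<bullet> w) / norm t) ^ k * ?I t)" for k
    by (rule integrable_ball_moment)
  have "(\<integral>t. (1 - 2 * m * ((t \<bullet> w) / norm t)\<^sup>2 + m * (m + 2) / 3 * ((t \<bullet> w) / norm t) ^ 4) * ?I t \<partial>lborel) =
      (\<integral>t. ((t \<bullet> w) / norm t) ^ 0 * ?I t - 2 * m * (((t \<bullet> w) / norm t)\<^sup>2 * ?I t) +
        m * (m + 2) / 3 * (((t \<bullet> w) / norm t) ^ 4 * ?I t) \<partial>lborel)"
    by (simp add: algebra_simps)
  also have "\<dots> = ball_moment 0 w - 2 * (m * ball_moment 2 w) + (m * (m + 2) * ball_moment 4 w) / 3"
    unfolding ball_moment_def using int[of 0]
    by (simp add: int del: power_0)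
  also have "\<dots> = measure lborel (cball (0::'a) 1) * (1 - (norm w)\<^sup>2)\<^sup>2"
    unfolding m_def ball_moment_2 ball_moment_4
    by (simp add: ball_moment_def power2_eq_square algebra_simps power4_eq_xxxx)
  finally show ?thesis .
qed

section \<open>Bodies of revolution\<close>

text \<open>The graph of the convex function A \<mapsto> A^(-k) lies above its tangent at B. The
  proof combines the Bernoulli inequality for B/A with A/B + B/A \<ge> 2.\<close>

lemma inverse_power_tangent:
  fixes A B :: real
  assumes "A > 0" "B > 0"
  shows "1 / B ^ k + real k * (B - A) / B ^ (k + 1) \<le> 1 / A ^ k"
proof -
  have "1 + real k * (1 - A / B) \<le> 1 + real k * (B / A - 1)"
  proof -
    have "0 \<le> (B - A)\<^sup>2 / (A * B)" using assms by simp
    also have "\<dots> = (B / A - 1) - (1 - A / B)" using assms by (simp add: field_simps power2_eq_square)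
    finally show ?thesis by (intro add_left_mono mult_left_mono) auto
  qed
  also have "\<dots> \<le> (1 + (B / A - 1)) ^ k"
    using assms by (intro Bernoulli_inequality) simp
  finally have "(1 + real k * (1 - A / B)) * (1 / B ^ k) \<le> (B / A) ^ k * (1 / B ^ k)"
    using assms by (intro mult_right_mono) auto
  then show ?thesis using assms by (simp add: field_simps power_divide)
qed

text \<open>Away from the origin F is a maximum of linear functionals. A convex combination that
  hits the origin has no such functional, and there nonnegativity together with F 0 = 0 does the
  job.\<close>

lemma convex_on_if_supporting:
  fixes F :: "'a::euclidean_space \<Rightarrow> real"
  assumes nonneg: "\<And>z. F z \<ge> 0" and zero: "F 0 = 0"
    and support: "\<And>z. z \<noteq> 0 \<Longrightarrow> \<exists>v. F z = z \<bullet> v \<and> (\<forall>x. x \<bullet> v \<le> F x)"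
  shows "convex_on UNIV F"
proof (rule convex_onI)
  fix t :: real and x y :: 'a
  assume t: "0 < t" "t < 1"
  let ?z = "(1 - t) *\<^sub>R x + t *\<^sub>R y"
  show "F ?z \<le> (1 - t) * F x + t * F y"
  proof (cases "?z = 0")
    case True
    then show ?thesis using t nonneg zero by simp
  next
    case False
    then obtain v where "F ?z = ?z \<bullet> v" and v: "\<And>x. x \<bullet> v \<le> F x" using support by blast
    then have "F ?z = (1 - t) * (x \<bullet> v) + t * (y \<bullet> v)" by (simp add: inner_add_left)
    also have "\<dots> \<le> (1 - t) * F x + t * F y"
      using t by (intro add_mono mult_left_mono v) auto
    finally show ?thesis .
  qed
qed simp

text \<open>The gauge of a body of revolution about \<open>e\<close>; the profile \<open>\<nu>\<close> is the reciprocal of the radial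
  function, in terms of the cosine of the angle to the axis.\<close>
definition revolve :: "'a::euclidean_space \<Rightarrow> (real \<Rightarrow> real) \<Rightarrow> 'a \<Rightarrow> real" where
  "revolve e \<nu> z = norm z * \<nu> ((z \<bullet> e) / norm z)"

lemma revolve_0 [simp]: "revolve e \<nu> 0 = 0"
  by (simp add: revolve_def)

lemma inner_div_norm_in_interval:
  fixes z e :: "'a::euclidean_space"
  assumes "norm e = 1"
  shows "(z \<bullet> e) / norm z \<in> {-1..1}"
  using abs_inner_div_norm_le[of z e] unfolding assms by (simp only: atLeastAtMost_iff) linarith

lemma revolve_minus:
  assumes "\<And>t. \<nu> (- t) = \<nu> t"
  shows "revolve e \<nu> (- z) = revolve e \<nu> z"
  by (simp add: revolve_def assms)

lemma revolve_scaleR: "c > 0 \<Longrightarrow> revolve e \<nu> (c *\<^sub>R z) = c * revolve e \<nu> z"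
  by (simp add: revolve_def)

lemma revolve_bounds:
  assumes e: "norm e = 1" and cont: "continuous_on UNIV \<nu>" and "a > 0"
    and bounds: "\<And>t. t \<in> {-1..1} \<Longrightarrow> a \<le> \<nu> t \<and> \<nu> t \<le> b"
  shows "continuous_on UNIV (revolve e \<nu>)" "a * norm z \<le> revolve e \<nu> z" "revolve e \<nu> z \<le> b * norm z"
proof -
  have le: "a * norm z \<le> revolve e \<nu> z" "revolve e \<nu> z \<le> b * norm z" for z
    using mult_left_mono[OF conjunct1[OF bounds[OF inner_div_norm_in_interval[OF e, of z]]], of "norm z"]
      mult_left_mono[OF conjunct2[OF bounds[OF inner_div_norm_in_interval[OF e, of z]]], of "norm z"]
    by (simp_all add: revolve_def mult.commute)
  then show "a * norm z \<le> revolve e \<nu> z" "revolve e \<nu> z \<le> b * norm z" by blast+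
  have "isCont (revolve e \<nu>) z" for z
  proof (cases "z = 0")
    case True
    \<comment> \<open>The cosine of the angle to the axis has no limit at the origin, so continuity
      there comes from squeezing between two multiples of the norm.\<close>
    have "(revolve e \<nu> \<longlongrightarrow> 0) (at 0)"
    proof (rule tendsto_sandwich)
      show "eventually (\<lambda>z. a * norm z \<le> revolve e \<nu> z) (at 0)" "eventually (\<lambda>z. revolve e \<nu> z \<le> b * norm z) (at 0)"
        using le by simp_all
      show "((\<lambda>z. a * norm z) \<longlongrightarrow> 0) (at (0::'a))" "((\<lambda>z. b * norm z) \<longlongrightarrow> 0) (at (0::'a))"
        by (auto intro!: tendsto_eq_intros)
    qed
    then show ?thesis using True by (simp add: isCont_def)
  next
    case False
    have "isCont \<nu> x" for x using cont by (simp add: continuous_on_eq_continuous_at)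
    moreover have "isCont (\<lambda>z. (z \<bullet> e) / norm z) z" using False by (intro continuous_intros) auto
    ultimately have "isCont (\<lambda>z. \<nu> ((z \<bullet> e) / norm z)) z" using isCont_o2 by blast
    then have "isCont (\<lambda>z. norm z * \<nu> ((z \<bullet> e) / norm z)) z" by (intro continuous_intros)
    then show ?thesis by (simp add: revolve_def[abs_def])
  qed
  then show "continuous_on UNIV (revolve e \<nu>)" by (simp add: continuous_at_imp_continuous_on)
qed

text \<open>The supporting functional at \<open>z\<close> with \<open>s = \<langle>z, e\<rangle> / |z|\<close> has gradient \<open>\<phi>' s e + (\<phi> s - s \<phi>' s + M) z / |z|\<close>;
  the curvature of \<open>M |z|\<close> absorbs the second order error of \<open>\<phi>\<close> because
  \<open>1 - \<langle>\<theta>, \<theta>'\<rangle> = |\<theta> - \<theta>'|^2 / 2 \<ge> (t - s)^2 / 2\<close> for unit vectors.\<close>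
lemma convex_on_revolve_add_const:
  fixes e :: "'a::euclidean_space"
  assumes e: "norm e = 1"
    and taylor: "\<And>s t. s \<in> {-1..1} \<Longrightarrow> t \<in> {-1..1} \<Longrightarrow> \<phi> s + \<phi>' s * (t - s) - C * (t - s)\<^sup>2 / 2 \<le> \<phi> t"
    and "C \<ge> 0" and M: "\<And>s. s \<in> {-1..1} \<Longrightarrow> C \<le> \<phi> s - s * \<phi>' s + M" "\<And>s. s \<in> {-1..1} \<Longrightarrow> 0 \<le> \<phi> s + M"
  shows "convex_on UNIV (revolve e (\<lambda>t. \<phi> t + M))"
proof (rule convex_on_if_supporting)
  fix z :: 'a
  show "0 \<le> revolve e (\<lambda>t. \<phi> t + M) z"
    unfolding revolve_def by (intro mult_nonneg_nonneg M(2) inner_div_norm_in_interval e) simp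
  assume "z \<noteq> 0"
  define s where "s = (z \<bullet> e) / norm z"
  have s: "s \<in> {-1..1}" unfolding s_def by (rule inner_div_norm_in_interval[OF e])
  have ze: "z \<bullet> e = norm z * s" using \<open>z \<noteq> 0\<close> by (simp add: s_def)
  define D where "D = \<phi> s - s * \<phi>' s + M"
  define v where "v = \<phi>' s *\<^sub>R e + (D / norm z) *\<^sub>R z"
  have "z \<bullet> v = \<phi>' s * (norm z * s) + (D / norm z) * (norm z * norm z)"
    by (simp add: v_def inner_add_right ze dot_square_norm power2_eq_square)
  also have "(D / norm z) * (norm z * norm z) = D * norm z" using \<open>z \<noteq> 0\<close> by simp
  also have "\<phi>' s * (norm z * s) + D * norm z = norm z * (\<phi> s + M)" by (simp add: D_def algebra_simps)
  finally have "z \<bullet> v = revolve e (\<lambda>t. \<phi> t + M) z" by (simp add: revolve_def s_def)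
  moreover have "x \<bullet> v \<le> revolve e (\<lambda>t. \<phi> t + M) x" for x
  proof (cases "x = 0")
    case False
    define t where "t = (x \<bullet> e) / norm x"
    have t: "t \<in> {-1..1}" unfolding t_def by (rule inner_div_norm_in_interval[OF e])
    define X where "X = x /\<^sub>R norm x"
    define Z where "Z = z /\<^sub>R norm z"
    define p where "p = (x \<bullet> z) / (norm x * norm z)"
    have "norm X = 1" "norm Z = 1" using False \<open>z \<noteq> 0\<close> by (simp_all add: X_def Z_def)
    have "t - s = (X - Z) \<bullet> e"
      by (simp add: X_def Z_def t_def s_def inner_diff_left divide_inverse mult.commute)
    also have "((X - Z) \<bullet> e)\<^sup>2 \<le> (norm (X - Z))\<^sup>2"
      using Cauchy_Schwarz_ineq2[of "X - Z" e] e abs_le_square_iff[of "(X - Z) \<bullet> e" "norm (X - Z)"] by simp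
    also have "(norm (X - Z))\<^sup>2 = (norm X)\<^sup>2 + (norm Z)\<^sup>2 - 2 * (X \<bullet> Z)"
      unfolding power2_norm_eq_inner by (simp add: inner_diff inner_commute)
    also have "X \<bullet> Z = p" by (simp add: X_def Z_def p_def divide_inverse mult_ac)
    finally have p: "(t - s)\<^sup>2 / 2 \<le> 1 - p" using \<open>norm X = 1\<close> \<open>norm Z = 1\<close> by simp
    have "C \<le> D" using M(1)[OF s] by (simp add: D_def)
    have "C * ((t - s)\<^sup>2 / 2) \<le> D * (1 - p)"
      using p \<open>C \<le> D\<close> \<open>C \<ge> 0\<close> by (intro mult_mono) auto
    then have "\<phi>' s * t + D * p \<le> \<phi> t + M" using taylor[OF s t] by (simp add: D_def algebra_simps)
    then have "norm x * (\<phi>' s * t + D * p) \<le> norm x * (\<phi> t + M)" by (intro mult_left_mono) auto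
    moreover have "x \<bullet> v = norm x * (\<phi>' s * t + D * p)"
      using False \<open>z \<noteq> 0\<close> by (simp add: v_def inner_add_right t_def p_def field_simps)
    ultimately show ?thesis by (simp add: revolve_def t_def)
  qed simp
  ultimately show "\<exists>v. revolve e (\<lambda>t. \<phi> t + M) z = z \<bullet> v \<and> (\<forall>x. x \<bullet> v \<le> revolve e (\<lambda>t. \<phi> t + M) x)"
    by metis
qed simp


text \<open>A sufficiently large multiple of the norm outweighs a perturbation with bounded second
  derivative; how large depends on bounds for p, p - s p' and p'' on [-1, 1].\<close>

lemma convex_on_revolve_polynomial:
  fixes e :: "'a::euclidean_space"
  assumes e: "norm e = 1" and p: "real_polynomial_function p"
  obtains M0 where "\<And>M. M \<ge> M0 \<Longrightarrow> convex_on UNIV (revolve e (\<lambda>t. p t + M))"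
proof -
  obtain p' where p': "real_polynomial_function p'" "\<And>x. (p has_real_derivative p' x) (at x)"
    using has_real_derivative_polynomial_function[OF p] by blast
  obtain p'' where p'': "real_polynomial_function p''" "\<And>x. (p' has_real_derivative p'' x) (at x)"
    using has_real_derivative_polynomial_function[OF p'(1)] by blast
  have bounded: "\<exists>B>0. \<forall>x\<in>{-1..1}. \<bar>q x\<bar> \<le> B" if "continuous_on {-1..1} q" for q :: "real \<Rightarrow> real"
    using compact_imp_bounded[OF compact_continuous_image[OF that compact_Icc]]
    by (auto simp: bounded_pos)
  have cont: "continuous_on {-1..1} p" "continuous_on {-1..1} p'" "continuous_on {-1..1} p''"
    using p p'(1) p''(1) continuous_on_polymonial_function by (auto simp: real_polynomial_function_eq)
  obtain C where C: "C > 0" "\<And>x. x \<in> {-1..1} \<Longrightarrow> \<bar>p'' x\<bar> \<le> C" using bounded[OF cont(3)] by blast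
  obtain B where B: "\<And>x. x \<in> {-1..1} \<Longrightarrow> \<bar>p x\<bar> \<le> B" using bounded[OF cont(1)] by blast
  have "continuous_on {-1..1} (\<lambda>x. p x - x * p' x)" by (intro continuous_intros cont)
  then obtain B' where B': "\<And>x. x \<in> {-1..1} \<Longrightarrow> \<bar>p x - x * p' x\<bar> \<le> B'" using bounded by blast
  have taylor: "p s + p' s * (t - s) - C * (t - s)\<^sup>2 / 2 \<le> p t" if s: "s \<in> {-1..1}" and t: "t \<in> {-1..1}" for s t
  proof -
    \<comment> \<open>With C a bound for |p''|, the function p + C x^2 / 2 is convex on the
      interval, and its tangent inequality rearranges to the quadratic lower bound for p.\<close>
    have "(p' s + C * s) * (t - s) \<le> (p t + C * t\<^sup>2 / 2) - (p s + C * s\<^sup>2 / 2)"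
    proof (rule f''_imp_f'[where C = "{-1..1}"])
      show "((\<lambda>x. p x + C * x\<^sup>2 / 2) has_real_derivative p' x + C * x) (at x)" for x
        by (auto intro!: derivative_eq_intros p'(2))
      show "((\<lambda>x. p' x + C * x) has_real_derivative p'' x + C) (at x)" for x
        by (auto intro!: derivative_eq_intros p''(2))
      show "0 \<le> p'' x + C" if "x \<in> {-1..1}" for x using C(2)[OF that] by linarith
    qed (use s t in auto)
    then show ?thesis by (simp add: power2_eq_square algebra_simps diff_divide_distrib add_divide_distrib)
  qed
  show ?thesis
  proof (rule that)
    fix M assume M: "M \<ge> \<bar>B\<bar> + \<bar>B'\<bar> + C"
    show "convex_on UNIV (revolve e (\<lambda>t. p t + M))"
    proof (rule convex_on_revolve_add_const[OF e taylor])
      show "C \<le> p s - s * p' s + M" "0 \<le> p s + M" if "s \<in> {-1..1}" for s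
        using B[OF that] B'[OF that] M \<open>C > 0\<close> by linarith+
    qed (use \<open>C > 0\<close> in auto)
  qed
qed

section \<open>The quartic and the truncated cylinder\<close>

text \<open>Its integral over the unit sphere of a central hyperplane whose normal makes the angle \<open>\<alpha>\<close> with the
  axis is proportional to \<open>cos^4 \<alpha>\<close>; here \<open>m\<close> is the dimension of the hyperplane.\<close>
definition quartic :: "nat \<Rightarrow> real \<Rightarrow> real" where
  "quartic m t = 1 - 2 * real m * t\<^sup>2 + real m * (real m + 2) / 3 * t ^ 4"

text \<open>Profile of the truncated cylinder \<open>|y| \<le> 1\<close>, \<open>|x| \<le> 3\<close>, for points \<open>z = x e + y\<close> with \<open>y\<close> orthogonal to \<open>e\<close>.\<close>
definition cyl :: "real \<Rightarrow> real" where
  "cyl t = max (sqrt (1 - t\<^sup>2)) (\<bar>t\<bar> / 3)"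

text \<open>With \<open>v = x / |y|\<close>, these are \<open>|z| / |y|\<close> and \<open>x / |z|\<close>.\<close>
definition hyp :: "real \<Rightarrow> real" where
  "hyp v = sqrt (1 + v\<^sup>2)"

definition slope :: "real \<Rightarrow> real" where
  "slope v = v / hyp v"

lemma hyp_ge_1: "1 \<le> hyp v" and hyp_pos: "0 < hyp v" and hyp_sq: "(hyp v)\<^sup>2 = 1 + v\<^sup>2" and abs_le_hyp: "\<bar>v\<bar> \<le> hyp v"
proof -
  show "1 \<le> hyp v" by (simp add: hyp_def)
  then show "0 < hyp v" by simp
  show "(hyp v)\<^sup>2 = 1 + v\<^sup>2" by (simp add: hyp_def)
  show "\<bar>v\<bar> \<le> hyp v" unfolding hyp_def by (rule real_le_rsqrt) simp
qed

lemma one_minus_slope_sq: "1 - (slope v)\<^sup>2 = 1 / (hyp v)\<^sup>2"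
proof -
  have "v\<^sup>2 = (hyp v)\<^sup>2 - 1" by (simp add: hyp_sq)
  then show ?thesis using hyp_pos[of v] by (simp add: slope_def power_divide diff_divide_distrib)
qed

lemma slope_in: "slope v \<in> {-1..1}"
  using abs_le_hyp[of v] hyp_pos[of v] by (auto simp: slope_def abs_le_iff field_simps)

lemma continuous_hyp: "continuous_on UNIV hyp"
  unfolding hyp_def[abs_def] by (intro continuous_intros)

lemma continuous_slope: "continuous_on UNIV slope"
  unfolding slope_def[abs_def] using hyp_pos by (intro continuous_intros continuous_hyp) (auto simp: less_imp_neq[THEN not_sym])

lemma continuous_quartic: "continuous_on S (quartic m)"
  unfolding quartic_def[abs_def] by (intro continuous_intros)

lemma continuous_cyl: "continuous_on S cyl"
  unfolding cyl_def[abs_def] by (intro continuous_intros) auto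

lemma borel_1d [measurable]: "hyp \<in> borel_measurable borel" "slope \<in> borel_measurable borel"
    "quartic m \<in> borel_measurable borel" "cyl \<in> borel_measurable borel"
  using continuous_hyp continuous_slope continuous_quartic continuous_cyl
  by (auto intro: borel_measurable_continuous_onI)

lemma cyl_minus: "cyl (- t) = cyl t"
  by (simp add: cyl_def)

lemma quartic_minus: "quartic m (- t) = quartic m t"
  by (simp add: quartic_def)

lemma cyl_le_1: "t \<in> {-1..1} \<Longrightarrow> cyl t \<le> 1"
  by (auto simp: cyl_def)

text \<open>From |t| = 3/4 on, the cap term |t|/3 is at least 1/4; for smaller |t| the side term is.
  The bound holds even for |t| > 1, where the root of a negative number is negative and the cap term
  decides.\<close>

lemma cyl_ge: "1 / 4 \<le> cyl t"
proof (cases "\<bar>t\<bar> \<ge> 3 / 4")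
  case False
  then have "\<bar>t\<bar> ^ 2 \<le> (3 / 4)\<^sup>2" by (intro power_mono) auto
  then have "1 / 4 \<le> sqrt (1 - t\<^sup>2)" by (intro real_le_rsqrt) (simp add: power2_eq_square)
  then show ?thesis by (simp add: cyl_def)
qed (simp add: cyl_def)

lemma cyl_slope: "cyl (slope v) = max 1 (\<bar>v\<bar> / 3) / hyp v"
proof -
  have "sqrt (1 - (slope v)\<^sup>2) = 1 / hyp v"
    unfolding one_minus_slope_sq using hyp_pos[of v] by (simp add: real_sqrt_divide)
  moreover have "\<bar>slope v\<bar> / 3 = (\<bar>v\<bar> / 3) / hyp v" using hyp_pos[of v] by (simp add: slope_def)
  ultimately show ?thesis
    unfolding cyl_def using hyp_pos[of v] by (simp add: max_divide_distrib_right)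
qed

section \<open>One-dimensional integrals against powers of \<open>1 / hyp v\<close>\<close>

lemma integrable_inverse_hyp_power:
  assumes "k \<ge> 2"
  shows "integrable lborel (\<lambda>v. 1 / hyp v ^ k)"
proof (rule Bochner_Integration.integrable_bound)
  have "set_integrable lborel (einterval (-\<infinity>) \<infinity>) (\<lambda>x::real. inverse (1 + x\<^sup>2))"
  proof (rule interval_integral_FTC_nonneg)
    show "(arctan has_real_derivative inverse (1 + x\<^sup>2)) (at x)" for x
      by (rule DERIV_arctan)
    show "isCont (\<lambda>x::real. inverse (1 + x\<^sup>2)) x" for x
      by (intro continuous_intros) (auto simp: add_nonneg_eq_0_iff)
    show "((arctan \<circ> real_of_ereal) \<longlongrightarrow> - (pi / 2)) (at_right (-\<infinity>))" "((arctan \<circ> real_of_ereal) \<longlongrightarrow> pi / 2) (at_left \<infinity>)"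
      using tendsto_arctan_at_bot tendsto_arctan_at_top by (simp_all add: ereal_tendsto_simps)
  qed (auto intro!: AE_I2)
  then show "integrable lborel (\<lambda>x::real. inverse (1 + x\<^sup>2))"
    by (simp add: set_integrable_def)
  have "1 / hyp v ^ k \<le> inverse (1 + v\<^sup>2)" for v
  proof -
    have "hyp v ^ 2 \<le> hyp v ^ k" using assms hyp_ge_1 by (intro power_increasing) auto
    then show ?thesis unfolding hyp_sq using hyp_pos[of v] by (simp add: field_simps inverse_eq_divide frac_le add_pos_nonneg)
  qed
  then show "AE v in lborel. norm (1 / hyp v ^ k) \<le> norm (inverse (1 + v\<^sup>2))"
    using hyp_pos by (intro AE_I2) (simp add: less_imp_le)
qed measurable

lemma integrable_bounded_div_hyp:
  assumes [measurable]: "f \<in> borel_measurable borel" and "\<And>t. t \<in> {-1..1} \<Longrightarrow> \<bar>f t\<bar> \<le> B" and "k \<ge> 2"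
  shows "integrable lborel (\<lambda>v. f (slope v) / hyp v ^ k)"
proof (rule Bochner_Integration.integrable_bound)
  show "integrable lborel (\<lambda>v. B * (1 / hyp v ^ k))"
    using \<open>k \<ge> 2\<close> by (intro integrable_mult_right integrable_inverse_hyp_power)
  have "\<bar>f (slope v)\<bar> \<le> \<bar>B\<bar>" for v using assms(2)[OF slope_in[of v]] by linarith
  then show "AE v in lborel. norm (f (slope v) / hyp v ^ k) \<le> norm (B * (1 / hyp v ^ k))"
    using hyp_pos by (intro AE_I2) (auto simp: abs_mult intro!: divide_right_mono)
qed measurable

lemma integrable_continuous_div_hyp:
  assumes "continuous_on UNIV f" and "k \<ge> 2"
  shows "integrable lborel (\<lambda>v. f (slope v) / hyp v ^ k)"
proof -
  have "bounded (f ` {-1..1})"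
    using assms by (intro compact_imp_bounded compact_continuous_image continuous_on_subset[OF assms(1)]) auto
  then obtain B where "\<forall>x\<in>f ` {-1..1}. norm x \<le> B" unfolding bounded_iff by blast
  then have "\<bar>f t\<bar> \<le> B" if "t \<in> {-1..1}" for t using that by simp
  then show ?thesis
    using assms by (intro integrable_bounded_div_hyp) (auto intro: borel_measurable_continuous_onI)
qed

text \<open>For the infinite cylinder \<open>|y| \<le> 1\<close> the integral vanishes, because
  \<open>(1 - t^2)^((m-1)/2) (t - m t^3 / 3)\<close> is an antiderivative in terms of \<open>t = v / sqrt (1 + v^2)\<close>.\<close>
lemma integral_quartic_hyp:
  assumes "m \<ge> 2"
  shows "(\<integral>v. quartic m (slope v) / hyp v ^ m \<partial>lborel) = 0"
proof -
  define F where "F = (\<lambda>v. (slope v - real m / 3 * slope v ^ 3) / hyp v ^ (m - 1))"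
  have dhyp: "(hyp has_real_derivative slope v) (at v)" for v
  proof -
    have "1 + v\<^sup>2 > 0" by (simp add: add_pos_nonneg)
    then have "((\<lambda>v. sqrt (1 + v\<^sup>2)) has_real_derivative (0 + 2 * v) * (inverse (sqrt (1 + v\<^sup>2)) / 2)) (at v)"
      by (auto intro!: derivative_eq_intros)
    also have "(0 + 2 * v) * (inverse (sqrt (1 + v\<^sup>2)) / 2) = slope v"
      by (simp add: slope_def hyp_def field_simps)
    also have "(\<lambda>v. sqrt (1 + v\<^sup>2)) = hyp" by (rule ext) (simp add: hyp_def)
    finally show ?thesis .
  qed
  have dslope: "(slope has_real_derivative (1 - (slope v)\<^sup>2) / hyp v) (at v)" for v
  proof -
    have "((\<lambda>v. v / hyp v) has_real_derivative (1 * hyp v - v * slope v) / (hyp v * hyp v)) (at v)"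
      by (rule DERIV_divide[OF DERIV_ident dhyp]) (use hyp_pos[of v] in simp)
    also have "(1 * hyp v - v * slope v) / (hyp v * hyp v) = (1 - (slope v)\<^sup>2) / hyp v"
      using hyp_pos[of v] by (simp add: slope_def diff_divide_distrib power2_eq_square)
    also have "(\<lambda>v. v / hyp v) = slope" by (rule ext) (simp add: slope_def)
    finally show ?thesis .
  qed
  have dF: "(F has_real_derivative quartic m (slope v) / hyp v ^ m) (at v)" for v
  proof -
    let ?t = "slope v" and ?w = "hyp v"
    have w: "?w > 0" by (rule hyp_pos)
    obtain j where j: "m = Suc (Suc j)" using assms by (metis Suc_le_D numeral_2_eq_2 Suc_le_mono)
    have "((\<lambda>v. slope v - real m / 3 * slope v ^ 3) has_real_derivative
        (1 - ?t\<^sup>2) / ?w - real m / 3 * (3 * ?t\<^sup>2 * ((1 - ?t\<^sup>2) / ?w))) (at v)"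
      by (auto intro!: derivative_eq_intros dslope simp: eval_nat_numeral)
    moreover have "((\<lambda>v. hyp v ^ (m - 1)) has_real_derivative real (m - 1) * ?w ^ (m - 2) * ?t) (at v)"
      using DERIV_power[OF dhyp[of v], of "m - 1"] by (simp add: j mult_ac)
    ultimately have "(F has_real_derivative
        (((1 - ?t\<^sup>2) / ?w - real m / 3 * (3 * ?t\<^sup>2 * ((1 - ?t\<^sup>2) / ?w))) * ?w ^ (m - 1) -
         (?t - real m / 3 * ?t ^ 3) * (real (m - 1) * ?w ^ (m - 2) * ?t)) / (?w ^ (m - 1) * ?w ^ (m - 1))) (at v)"
      unfolding F_def by (rule DERIV_divide) (use w in simp)
    also have "(((1 - ?t\<^sup>2) / ?w - real m / 3 * (3 * ?t\<^sup>2 * ((1 - ?t\<^sup>2) / ?w))) * ?w ^ (m - 1) -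
         (?t - real m / 3 * ?t ^ 3) * (real (m - 1) * ?w ^ (m - 2) * ?t)) / (?w ^ (m - 1) * ?w ^ (m - 1)) =
        ((1 - ?t\<^sup>2) - real m * ?t\<^sup>2 * (1 - ?t\<^sup>2) - (?t - real m / 3 * ?t ^ 3) * real (m - 1) * ?t) / ?w ^ m"
      using w by (simp add: j field_simps)
    also have "(1 - ?t\<^sup>2) - real m * ?t\<^sup>2 * (1 - ?t\<^sup>2) - (?t - real m / 3 * ?t ^ 3) * real (m - 1) * ?t = quartic m ?t"
      by (simp add: j quartic_def field_simps power2_eq_square power3_eq_cube power4_eq_xxxx)
    finally show ?thesis .
  qed
  \<comment> \<open>For m \<ge> 2 the denominator of \<open>F\<close> contains at least one factor
    \<open>hyp v\<close>, while the numerator is bounded; hence the boundary terms vanish at both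
    ends.\<close>
  have F_bound: "\<bar>F v\<bar> \<le> (1 + real m) * inverse \<bar>v\<bar>" if "v \<noteq> 0" for v
  proof -
    have "\<bar>slope v\<bar> \<le> 1" using slope_in[of v] by auto
    then have s: "\<bar>slope v\<bar> ^ 3 \<le> 1" by (intro power_le_one) auto
    have "\<bar>slope v - real m / 3 * slope v ^ 3\<bar> \<le> \<bar>slope v\<bar> + real m / 3 * \<bar>slope v\<bar> ^ 3"
      using abs_triangle_ineq4[of "slope v" "real m / 3 * slope v ^ 3"] by (simp add: abs_mult power_abs)
    also have "\<dots> \<le> 1 + real m * 1"
      using s \<open>\<bar>slope v\<bar> \<le> 1\<close> by (intro add_mono mult_mono) auto
    finally have 1: "\<bar>slope v - real m / 3 * slope v ^ 3\<bar> \<le> 1 + real m" by simp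
    have "hyp v ^ 1 \<le> hyp v ^ (m - 1)" using assms hyp_ge_1[of v] by (intro power_increasing) auto
    then have 2: "\<bar>v\<bar> \<le> hyp v ^ (m - 1)" using abs_le_hyp[of v] by simp
    have "\<bar>F v\<bar> = \<bar>slope v - real m / 3 * slope v ^ 3\<bar> / hyp v ^ (m - 1)"
      using hyp_pos[of v] by (simp add: F_def abs_divide)
    also have "\<dots> \<le> (1 + real m) / \<bar>v\<bar>"
      using that by (intro frac_le 1 2) auto
    finally show ?thesis by (simp add: divide_inverse)
  qed
  have lim_bound: "((\<lambda>v::real. (1 + real m) * inverse \<bar>v\<bar>) \<longlongrightarrow> 0) at_infinity"
    using tendsto_mult_right_zero[OF tendsto_norm_zero[OF tendsto_inverse_0[where 'a = real]], of "1 + real m"]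
    by (simp add: abs_inverse)
  have "(F \<longlongrightarrow> 0) at_infinity"
    by (rule Lim_null_comparison[OF _ lim_bound])
       (use F_bound in \<open>auto simp: eventually_at_infinity intro!: exI[of _ 1]\<close>)
  then have lim: "(F \<longlongrightarrow> 0) at_top" "(F \<longlongrightarrow> 0) at_bot"
    using at_top_le_at_infinity at_bot_le_at_infinity by (auto intro: tendsto_mono)
  have int: "integrable lborel (\<lambda>v. quartic m (slope v) / hyp v ^ m)"
    using assms by (intro integrable_continuous_div_hyp continuous_quartic) auto
  have "(LBINT v=-\<infinity>..\<infinity>. quartic m (slope v) / hyp v ^ m) = 0 - 0"
  proof (rule interval_integral_FTC_integrable)
    show "(F has_vector_derivative quartic m (slope x) / hyp x ^ m) (at x)" for x
      using dF by (simp add: has_real_derivative_iff_has_vector_derivative)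
    show "isCont (\<lambda>v. quartic m (slope v) / hyp v ^ m) x" for x
    proof -
      have "continuous_on UNIV (\<lambda>v. quartic m (slope v) / hyp v ^ m)"
        using hyp_pos
        by (intro continuous_intros continuous_hyp continuous_on_compose2[OF continuous_quartic continuous_slope])
          (auto simp: less_imp_neq[THEN not_sym])
      then show ?thesis by (simp add: continuous_on_eq_continuous_at)
    qed
    show "set_integrable lborel (einterval (-\<infinity>) \<infinity>) (\<lambda>v. quartic m (slope v) / hyp v ^ m)"
      using int by (simp add: set_integrable_def)
    show "((F \<circ> real_of_ereal) \<longlongrightarrow> 0) (at_right (-\<infinity>))" "((F \<circ> real_of_ereal) \<longlongrightarrow> 0) (at_left \<infinity>)"
      using lim by (simp_all add: ereal_tendsto_simps)
  qed simp
  then show ?thesis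
    by (simp add: interval_lebesgue_integral_def set_lebesgue_integral_def)
qed

text \<open>Truncating the cylinder only lowers the radial function where \<open>|v| > 3\<close>, and there the quartic is positive.\<close>
lemma integral_quartic_cyl_neg:
  assumes "m \<ge> 4"
  shows "(\<integral>v. quartic m (slope v) / cyl (slope v) / hyp v ^ (m + 1) \<partial>lborel) < 0"
proof -
  \<comment> \<open>The ratio of the radial functions of the truncated and the infinite cylinder; it
    is 1 for |v| \<le> 3.\<close>
  define \<psi> where "\<psi> = (\<lambda>v::real. 1 / max 1 (\<bar>v\<bar> / 3))"
  define h where "h = (\<lambda>v. quartic m (slope v) / hyp v ^ m)"
  have eq: "quartic m (slope v) / cyl (slope v) / hyp v ^ (m + 1) = h v * \<psi> v" for v
    using hyp_pos[of v] by (simp add: cyl_slope h_def \<psi>_def)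
  have pos: "quartic m (slope v) > 0" if "\<bar>v\<bar> \<ge> 3" for v
  proof -
    define r where "r = real m"
    have "r \<ge> 4" using assms by (simp add: r_def)
    have "3\<^sup>2 \<le> \<bar>v\<bar>\<^sup>2" using that by (intro power_mono) auto
    then have v2: "9 \<le> v\<^sup>2" by simp
    have "hyp v ^ 4 * quartic m (slope v) = ((hyp v)\<^sup>2)\<^sup>2 - 2 * r * v\<^sup>2 * (hyp v)\<^sup>2 + r * (r + 2) / 3 * v ^ 4"
      using hyp_pos[of v] by (simp add: quartic_def slope_def r_def field_simps flip: power_mult)
    \<comment> \<open>This form shows why the cylinder is cut at 3: with r \<ge> 4 and v^2 \<ge> 9
      the last factor is at least 3 - 2. For r = 3 it would be negative for every v.\<close>
    also have "\<dots> = 1 + (r - 1) * v\<^sup>2 * ((r - 3) / 3 * v\<^sup>2 - 2)"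
      unfolding hyp_sq by (simp add: field_simps power2_eq_square power4_eq_xxxx)
    also have "\<dots> > 0"
    proof -
      have "1 * 9 \<le> (r - 3) * v\<^sup>2" using \<open>r \<ge> 4\<close> v2 by (intro mult_mono) auto
      then have "0 \<le> (r - 1) * v\<^sup>2 * ((r - 3) / 3 * v\<^sup>2 - 2)" using \<open>r \<ge> 4\<close> by (intro mult_nonneg_nonneg) auto
      then show ?thesis by simp
    qed
    finally show ?thesis using hyp_pos[of v] by (simp add: zero_less_mult_iff)
  qed
  have int_h: "integrable lborel h"
    unfolding h_def using assms by (intro integrable_continuous_div_hyp continuous_quartic) auto
  have cyl_nz: "cyl t \<noteq> 0" for t using cyl_ge[of t] by auto
  have "integrable lborel (\<lambda>v. (quartic m (slope v) / cyl (slope v)) / hyp v ^ (m + 1))"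
    using assms cyl_nz
    by (intro integrable_continuous_div_hyp[where f = "\<lambda>t. quartic m t / cyl t"] continuous_intros continuous_quartic continuous_cyl)
       auto
  then have int_hp: "integrable lborel (\<lambda>v. h v * \<psi> v)" by (simp only: eq)
  have int: "integrable lborel (\<lambda>v. h v * (1 - \<psi> v))"
    using Bochner_Integration.integrable_diff[OF int_h int_hp] by (simp add: algebra_simps)
  have "(\<integral>v. h v * \<psi> v \<partial>lborel) = (\<integral>v. h v \<partial>lborel) - (\<integral>v. h v * (1 - \<psi> v) \<partial>lborel)"
    using Bochner_Integration.integral_diff[OF int_h int_hp] by (simp add: algebra_simps)
  also have "(\<integral>v. h v \<partial>lborel) = 0" unfolding h_def using assms by (intro integral_quartic_hyp) auto
  finally have I: "(\<integral>v. h v * \<psi> v \<partial>lborel) = - (\<integral>v. h v * (1 - \<psi> v) \<partial>lborel)" by simp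
  have nonneg: "0 \<le> h v * (1 - \<psi> v)" for v
  proof (cases "\<bar>v\<bar> \<ge> 3")
    case True
    then show ?thesis using pos[OF True] hyp_pos[of v] by (intro mult_nonneg_nonneg) (auto simp: h_def \<psi>_def)
  qed (simp add: \<psi>_def)
  have "(\<integral>v. h v * (1 - \<psi> v) \<partial>lborel) \<noteq> 0"
  proof
    assume "(\<integral>v. h v * (1 - \<psi> v) \<partial>lborel) = 0"
    then have "AE v in lborel. h v * (1 - \<psi> v) = 0"
      using integral_nonneg_eq_0_iff_AE[OF int] nonneg by simp
    moreover have "h v * (1 - \<psi> v) \<noteq> 0" if "v > 3" for v
      using pos[of v] hyp_pos[of v] that by (auto simp: h_def \<psi>_def)
    ultimately have "AE v in lborel. v \<notin> {4..5::real}" by (auto elim: eventually_mono)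
    then have "{4..5::real} \<in> null_sets lborel" by (simp add: AE_iff_null_sets)
    then show False by (simp add: null_sets_def)
  qed
  moreover have "(\<integral>v. h v * (1 - \<psi> v) \<partial>lborel) \<ge> 0" by (intro integral_nonneg_AE AE_I2 nonneg)
  ultimately show ?thesis unfolding eq I by linarith
qed

section \<open>Volumes of bodies of revolution\<close>

lemma exists_isometry_onto_hyperplane:
  fixes e :: "'a::euclidean_space"
  assumes "e \<noteq> 0" "DIM('b::euclidean_space) + 1 = DIM('a)"
  obtains f :: "'b::euclidean_space \<Rightarrow> 'a" where "linear f" "\<And>y. norm (f y) = norm y" "\<And>y. f y \<bullet> e = 0"
proof -
  have "dim (UNIV :: 'b set) = dim {x. e \<bullet> x = 0}"
    using assms dim_hyperplane[OF \<open>e \<noteq> 0\<close>] by simp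
  then obtain f :: "'b \<Rightarrow> 'a" where "linear f" "range f = {x. e \<bullet> x = 0}" "\<And>y. norm (f y) = norm y"
    using isometry_subspaces[OF subspace_UNIV subspace_hyperplane] by (metis UNIV_I)
  then show ?thesis using that by (metis (mono_tags, lifting) inner_commute mem_Collect_eq rangeI)
qed

text \<open>The factor that integration over y leaves behind in cylindrical coordinates; the
  integrand |y| is the Jacobian of x = |y| v. It is common to both bodies, so comparing their
  volumes requires only that it be finite and positive.\<close>

definition cyl_const :: "'b::euclidean_space itself \<Rightarrow> real" where
  "cyl_const _ = (\<integral>y. norm (y::'b) * indicator (cball 0 1) y \<partial>lborel)"

lemma cyl_const: "(\<integral>\<^sup>+y. ennreal (norm (y::'b::euclidean_space)) * indicator (cball 0 1) y \<partial>lborel) = ennreal (cyl_const TYPE('b))"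
  and cyl_const_pos: "cyl_const TYPE('b::euclidean_space) > 0"
proof -
  have int: "integrable lborel (\<lambda>y::'b. norm y * indicator (cball 0 1) y)"
  proof (rule Bochner_Integration.integrable_bound)
    show "integrable lborel (\<lambda>y::'b. indicator (cball 0 1) y :: real)"
      by (intro integrable_real_indicator) (auto simp: emeasure_cball)
  qed (auto simp: indicator_def)
  have "(\<integral>\<^sup>+y. ennreal (norm (y::'b)) * indicator (cball 0 1) y \<partial>lborel) = (\<integral>\<^sup>+y. ennreal (norm (y::'b) * indicator (cball 0 1) y) \<partial>lborel)"
    by (intro nn_integral_cong) (auto simp: indicator_def)
  then show "(\<integral>\<^sup>+y. ennreal (norm (y::'b)) * indicator (cball 0 1) y \<partial>lborel) = ennreal (cyl_const TYPE('b))"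
    unfolding cyl_const_def by (simp add: nn_integral_eq_integral[OF int])
  have "(\<integral>y. norm (y::'b) * indicator (cball 0 1) y \<partial>lborel) \<noteq> 0"
  proof
    assume "(\<integral>y. norm (y::'b) * indicator (cball 0 1) y \<partial>lborel) = 0"
    then have "AE y in lborel. norm (y::'b) * indicator (cball 0 1) y = 0"
      using integral_nonneg_eq_0_iff_AE[OF int] by simp
    with AE_lborel_singleton[of "0::'b"] have "AE y in lborel. y \<notin> cball (0::'b) 1"
      by eventually_elim (auto simp: indicator_def)
    then have "cball (0::'b) 1 \<in> null_sets lborel" by (simp add: AE_iff_null_sets)
    then show False by (simp add: null_sets_def emeasure_cball less_imp_neq[THEN not_sym])
  qed
  moreover have "(\<integral>y. norm (y::'b) * indicator (cball 0 1) y \<partial>lborel) \<ge> 0"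
    by (intro integral_nonneg_AE) (auto simp: indicator_def)
  ultimately show "cyl_const TYPE('b) > 0" unfolding cyl_const_def by linarith
qed

text \<open>Cylindrical coordinates \<open>z = |y| v e + y\<close> with \<open>y\<close> orthogonal to \<open>e\<close>.\<close>
lemma emeasure_revolve_le_1:
  fixes e :: "'a::euclidean_space"
  assumes e: "norm e = 1" and dim: "DIM('b::euclidean_space) + 1 = DIM('a)"
    and cont: "continuous_on UNIV (revolve e \<nu>)" and [measurable]: "\<nu> \<in> borel_measurable borel"
    and pos: "\<And>t. t \<in> {-1..1} \<Longrightarrow> \<nu> t > 0"
  shows "emeasure lborel {z. revolve e \<nu> z \<le> 1} =
    ennreal (cyl_const TYPE('b)) * (\<integral>\<^sup>+v. ennreal (1 / (hyp v * \<nu> (slope v)) ^ DIM('a)) \<partial>lborel)"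
proof -
  let ?m = "DIM('b)"
  define n where "n = (\<lambda>v. hyp v * \<nu> (slope v))"
  have n: "n v > 0" for v unfolding n_def by (intro mult_pos_pos hyp_pos pos slope_in)
  have [measurable]: "n \<in> borel_measurable borel" unfolding n_def by measurable
  have [measurable]: "revolve e \<nu> \<in> borel_measurable borel"
    using cont by (rule borel_measurable_continuous_onI)
  have "e \<noteq> 0" using e by auto
  then obtain f :: "'b \<Rightarrow> 'a" where f: "linear f" "\<And>y. norm (f y) = norm y" "\<And>y. f y \<bullet> e = 0"
    using exists_isometry_onto_hyperplane[OF _ dim] by blast
  define T where "T = (\<lambda>(x::real, y::'b). x *\<^sub>R e + f y)"
  have "linear T"
    unfolding T_def by (rule linearI) (auto simp: algebra_simps linear_add[OF f(1)] linear_cmul[OF f(1)])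
  have T_norm: "norm (T p) = norm p" for p
  proof -
    obtain x y where p: "p = (x, y)" by (cases p)
    have "e \<bullet> f y = 0" using f(3) by (simp add: inner_commute)
    then have "(norm (T p))\<^sup>2 = x\<^sup>2 + (norm y)\<^sup>2"
      using e f(2)[of y] unfolding p T_def power2_norm_eq_inner
      by (simp add: inner_add inner_commute f(3) power2_eq_square norm_eq_1 norm_eq)
    also have "\<dots> = (norm p)\<^sup>2" by (simp add: p norm_Pair)
    finally show ?thesis by simp
  qed
  have [measurable]: "T \<in> borel_measurable borel"
    using \<open>linear T\<close> by (simp add: borel_measurable_continuous_onI linear_continuous_on linear_conv_bounded_linear)
  have [measurable]: "(\<lambda>p. T p) \<in> borel_measurable (lborel \<Otimes>\<^sub>M lborel)" unfolding lborel_prod by simp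
  have [measurable]: "T \<in> borel_measurable (borel \<Otimes>\<^sub>M borel)" unfolding borel_prod by simp
  define H where "H = (\<lambda>x y. indicator {z. revolve e \<nu> z \<le> 1} (T (x, y)) :: ennreal)"
  have [measurable]: "case_prod H \<in> borel_measurable (lborel \<Otimes>\<^sub>M lborel)"
    unfolding H_def by measurable
  have [measurable]: "(\<lambda>x. H x y) \<in> borel_measurable borel" for y
    unfolding H_def by measurable
  have H: "H (norm y * v) y = indicator {..1} (norm y * n v)" if "y \<noteq> 0" for y v
  proof -
    have nT: "norm (T (norm y * v, y)) = norm y * hyp v"
    proof -
      have "norm (T (norm y * v, y)) = sqrt ((norm y)\<^sup>2 * (1 + v\<^sup>2))"
        unfolding T_norm norm_Pair by (simp add: power_mult_distrib algebra_simps)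
      then show ?thesis by (simp add: real_sqrt_mult hyp_def)
    qed
    moreover have "T (norm y * v, y) \<bullet> e = norm y * v"
      using e by (simp add: T_def inner_add_left f(3) norm_eq_1)
    ultimately have "revolve e \<nu> (T (norm y * v, y)) = norm y * n v"
      using that by (simp add: revolve_def n_def slope_def)
    then show ?thesis by (simp add: H_def indicator_def)
  qed
  have "emeasure lborel {z. revolve e \<nu> z \<le> 1} = emeasure (distr lborel borel T) {z. revolve e \<nu> z \<le> 1}"
    using distr_lborel_isometry[OF \<open>linear T\<close> T_norm] dim by simp
  also have "\<dots> = (\<integral>\<^sup>+p. indicator {z. revolve e \<nu> z \<le> 1} (T p) \<partial>lborel)"
    by (simp add: nn_integral_distr flip: nn_integral_indicator)
  also have "\<dots> = (\<integral>\<^sup>+p. case_prod H p \<partial>(lborel \<Otimes>\<^sub>M lborel))"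
    by (simp add: lborel_prod H_def case_prod_beta)
  also have "\<dots> = (\<integral>\<^sup>+y. (\<integral>\<^sup>+x. H x y \<partial>lborel) \<partial>lborel)"
    using lborel_pair.nn_integral_snd[of "case_prod H"] by simp
  also have "\<dots> = (\<integral>\<^sup>+y. (\<integral>\<^sup>+v. ennreal (norm y) * indicator {..1} (norm y * n v) \<partial>lborel) \<partial>(lborel :: 'b measure))"
  proof (rule nn_integral_cong_AE)
    show "AE y in lborel. (\<integral>\<^sup>+x. H x y \<partial>lborel) = (\<integral>\<^sup>+v. ennreal (norm y) * indicator {..1} (norm y * n v) \<partial>lborel)"
      using AE_lborel_singleton[of "0::'b"]
    proof eventually_elim
      fix y :: 'b assume "y \<noteq> 0"
      have "(\<integral>\<^sup>+x. H x y \<partial>lborel) = ennreal (norm y) * (\<integral>\<^sup>+v. H (norm y * v) y \<partial>lborel)"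
        using \<open>y \<noteq> 0\<close> nn_integral_real_affine[of "\<lambda>x. H x y" "norm y" 0] by simp
      also have "\<dots> = (\<integral>\<^sup>+v. ennreal (norm y) * indicator {..1} (norm y * n v) \<partial>lborel)"
        unfolding H[OF \<open>y \<noteq> 0\<close>] by (rule nn_integral_cmult[symmetric]) measurable
      finally show "(\<integral>\<^sup>+x. H x y \<partial>lborel) = (\<integral>\<^sup>+v. ennreal (norm y) * indicator {..1} (norm y * n v) \<partial>lborel)" .
    qed
  qed
  also have "\<dots> = (\<integral>\<^sup>+v. (\<integral>\<^sup>+y. ennreal (norm (y::'b)) * indicator {..1} (norm y * n v) \<partial>lborel) \<partial>lborel)"
    by (rule lborel_pair.Fubini') measurable
  also have "\<dots> = (\<integral>\<^sup>+v. ennreal (cyl_const TYPE('b)) * ennreal (1 / n v ^ DIM('a)) \<partial>lborel)"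
  proof (rule nn_integral_cong)
    fix v
    \<comment> \<open>Scaling y by 1 / n v yields m factors 1 / n v from the Jacobian and one more
      from the weight |y|, together the exponent m + 1 = \<open>DIM('a)\<close>.\<close>
    have "(\<integral>\<^sup>+y. ennreal (norm (y::'b)) * indicator {..1} (norm y * n v) \<partial>lborel) =
        ennreal (\<bar>1 / n v\<bar> ^ ?m) * (\<integral>\<^sup>+y. ennreal (norm ((1 / n v) *\<^sub>R (y::'b))) * indicator {..1} (norm ((1 / n v) *\<^sub>R y) * n v) \<partial>lborel)"
      using n[of v] by (intro nn_integral_lborel_scaleR) auto
    also have "(\<integral>\<^sup>+y. ennreal (norm ((1 / n v) *\<^sub>R (y::'b))) * indicator {..1} (norm ((1 / n v) *\<^sub>R y) * n v) \<partial>lborel) =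
        (\<integral>\<^sup>+y. ennreal (1 / n v) * (ennreal (norm (y::'b)) * indicator (cball 0 1) y) \<partial>lborel)"
      using n[of v] by (intro nn_integral_cong) (auto simp: indicator_def simp flip: ennreal_mult)
    also have "\<dots> = ennreal (1 / n v) * ennreal (cyl_const TYPE('b))"
      by (subst nn_integral_cmult) (auto simp: cyl_const)
    also have "ennreal (\<bar>1 / n v\<bar> ^ ?m) * (ennreal (1 / n v) * ennreal (cyl_const TYPE('b))) =
        ennreal (cyl_const TYPE('b)) * ennreal (1 / n v ^ DIM('a))"
      using n[of v] cyl_const_pos[where 'b = 'b]
      by (simp add: power_divide mult_ac flip: ennreal_mult dim)
    finally show "(\<integral>\<^sup>+y. ennreal (norm (y::'b)) * indicator {..1} (norm y * n v) \<partial>lborel) =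
      ennreal (cyl_const TYPE('b)) * ennreal (1 / n v ^ DIM('a))" .
  qed
  also have "\<dots> = ennreal (cyl_const TYPE('b)) * (\<integral>\<^sup>+v. ennreal (1 / n v ^ DIM('a)) \<partial>lborel)"
    by (rule nn_integral_cmult) measurable
  finally show ?thesis by (simp add: n_def)
qed

lemma measure_revolve_le_1:
  fixes e :: "'a::euclidean_space"
  assumes e: "norm e = 1" and dim: "DIM('b::euclidean_space) + 1 = DIM('a)"
    and cont: "continuous_on UNIV \<nu>" and "a > 0"
    and bounds: "\<And>t. t \<in> {-1..1} \<Longrightarrow> a \<le> \<nu> t \<and> \<nu> t \<le> b"
  shows "integrable lborel (\<lambda>v. 1 / (hyp v * \<nu> (slope v)) ^ DIM('a))"
    and "measure lborel {z. revolve e \<nu> z \<le> 1} =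
      cyl_const TYPE('b) * (\<integral>v. 1 / (hyp v * \<nu> (slope v)) ^ DIM('a) \<partial>lborel)"
proof -
  let ?n = "DIM('a)"
  have [measurable]: "\<nu> \<in> borel_measurable borel" using cont by (rule borel_measurable_continuous_onI)
  have pos: "\<nu> t > 0" if "t \<in> {-1..1}" for t using bounds[OF that] \<open>a > 0\<close> by linarith
  have "?n \<ge> 2" using dim DIM_positive[where 'a = 'b] by linarith
  have "\<bar>1 / \<nu> t ^ ?n\<bar> \<le> 1 / a ^ ?n" if "t \<in> {-1..1}" for t
    using bounds[OF that] pos[OF that] \<open>a > 0\<close> by (auto intro!: divide_left_mono power_mono)
  then have "integrable lborel (\<lambda>v. (1 / \<nu> (slope v) ^ ?n) / hyp v ^ ?n)"
    using \<open>?n \<ge> 2\<close> by (intro integrable_bounded_div_hyp[where f = "\<lambda>t. 1 / \<nu> t ^ ?n"]) auto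
  then show int: "integrable lborel (\<lambda>v. 1 / (hyp v * \<nu> (slope v)) ^ ?n)"
    by (simp add: power_mult_distrib mult.commute)
  have nn: "0 \<le> 1 / (hyp v * \<nu> (slope v)) ^ ?n" for v
    using hyp_pos[of v] pos[OF slope_in[of v]] by simp
  have "emeasure lborel {z. revolve e \<nu> z \<le> 1} =
    ennreal (cyl_const TYPE('b)) * (\<integral>\<^sup>+v. ennreal (1 / (hyp v * \<nu> (slope v)) ^ ?n) \<partial>lborel)"
    by (intro emeasure_revolve_le_1 e dim pos revolve_bounds(1)[OF e cont \<open>a > 0\<close> bounds]) auto
  also have "\<dots> = ennreal (cyl_const TYPE('b) * (\<integral>v. 1 / (hyp v * \<nu> (slope v)) ^ ?n \<partial>lborel))"
    using cyl_const_pos[where 'b = 'b] nn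
    by (subst nn_integral_eq_integral[OF int]) (auto simp: ennreal_mult)
  finally show "measure lborel {z. revolve e \<nu> z \<le> 1} =
      cyl_const TYPE('b) * (\<integral>v. 1 / (hyp v * \<nu> (slope v)) ^ ?n \<partial>lborel)"
    using cyl_const_pos[where 'b = 'b] nn
    by (simp add: measure_def integral_nonneg_AE)
qed

text \<open>As f is isometric, the gauge restricted to the section is |t| \<nu> ((t \<bullet> w) /
  |t|), where w represents the projection of the axis. The polar coordinate formula then applies
  inside the section.\<close>

lemma measure_section_revolve_le_1:
  fixes e :: "'a::euclidean_space" and f :: "'b::euclidean_space \<Rightarrow> 'a"
  assumes e: "norm e = 1" and f: "linear f" "\<And>t. norm (f t) = norm t"
    and w: "\<And>t. f t \<bullet> e = t \<bullet> w"
    and cont: "continuous_on UNIV \<nu>" and "a > 0"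
    and bounds: "\<And>t. t \<in> {-1..1} \<Longrightarrow> a \<le> \<nu> t \<and> \<nu> t \<le> b"
  shows "integrable lborel (\<lambda>t. 1 / \<nu> ((t \<bullet> w) / norm t) ^ DIM('b) * indicator (cball 0 1) t)"
    and "measure lborel {t. revolve e \<nu> (f t) \<le> 1} =
      (\<integral>t. 1 / \<nu> ((t \<bullet> w) / norm t) ^ DIM('b) * indicator (cball 0 1) t \<partial>lborel)"
proof -
  let ?m = "DIM('b)"
  have [measurable]: "\<nu> \<in> borel_measurable borel" using cont by (rule borel_measurable_continuous_onI)
  have [measurable]: "f \<in> borel_measurable borel"
    using f by (simp add: borel_measurable_continuous_onI linear_continuous_on linear_conv_bounded_linear)
  have [measurable]: "revolve e \<nu> \<in> borel_measurable borel"
    using revolve_bounds(1)[OF e cont \<open>a > 0\<close> bounds] by (rule borel_measurable_continuous_onI)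
  have \<tau>: "(t \<bullet> w) / norm t \<in> {-1..1}" for t
    using inner_div_norm_in_interval[OF e, of "f t"] by (simp add: f w)
  have pos: "\<nu> ((t \<bullet> w) / norm t) > 0" for t using bounds[OF \<tau>[of t]] \<open>a > 0\<close> by linarith
  have "\<bar>1 / \<nu> ((t \<bullet> w) / norm t) ^ ?m\<bar> \<le> 1 / a ^ ?m" for t
    using bounds[OF \<tau>[of t]] pos[of t] \<open>a > 0\<close> by (auto intro!: divide_left_mono power_mono)
  then show int: "integrable lborel (\<lambda>t. 1 / \<nu> ((t \<bullet> w) / norm t) ^ ?m * indicator (cball 0 1) t)"
    by (intro integrable_cball_bounded) auto
  have rev: "revolve e \<nu> (f t) = norm t * \<nu> ((t \<bullet> w) / norm t)" for t
    by (simp add: revolve_def f w)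
  have "emeasure lborel {t. revolve e \<nu> (f t) \<le> 1} =
      (\<integral>\<^sup>+t. ennreal ((norm t / revolve e \<nu> (f t)) ^ ?m) * indicator (cball 0 1) t \<partial>lborel)"
  proof (rule emeasure_gauge_le_1)
    show "revolve e \<nu> (f (c *\<^sub>R x)) = c * revolve e \<nu> (f x)" if "c > 0" for c x
      using that by (simp add: linear_cmul[OF f(1)] revolve_scaleR)
    show "revolve e \<nu> (f x) > 0" if "x \<noteq> 0" for x using that pos[of x] by (simp add: rev)
  qed measurable
  also have "\<dots> = (\<integral>\<^sup>+t. ennreal (1 / \<nu> ((t \<bullet> w) / norm t) ^ ?m * indicator (cball 0 1) t) \<partial>lborel)"
  proof (rule nn_integral_cong_AE)
    show "AE t in lborel. ennreal ((norm t / revolve e \<nu> (f t)) ^ ?m) * indicator (cball 0 1) t =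
        ennreal (1 / \<nu> ((t \<bullet> w) / norm t) ^ ?m * indicator (cball 0 1) t)"
      using AE_lborel_singleton[of "0::'b"]
      by eventually_elim (simp add: rev power_divide power_mult_distrib indicator_def)
  qed
  also have "\<dots> = ennreal (\<integral>t. 1 / \<nu> ((t \<bullet> w) / norm t) ^ ?m * indicator (cball 0 1) t \<partial>lborel)"
    using pos by (intro nn_integral_eq_integral[OF int]) (auto simp: less_imp_le indicator_def)
  finally show "measure lborel {t. revolve e \<nu> (f t) \<le> 1} =
      (\<integral>t. 1 / \<nu> ((t \<bullet> w) / norm t) ^ ?m * indicator (cball 0 1) t \<partial>lborel)"
    using pos by (simp add: measure_def integral_nonneg_AE less_imp_le indicator_def)
qed

section \<open>Perturbing the truncated cylinder\<close>

lemma uniform_limit_parameter: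
  fixes K :: "real \<Rightarrow> real \<Rightarrow> real"
  assumes "continuous_on ({0..1} \<times> {-1..1}) (\<lambda>p. K (fst p) (snd p))" "e > 0"
  shows "\<exists>d>0. \<forall>\<delta> t. 0 \<le> \<delta> \<longrightarrow> \<delta> < d \<longrightarrow> \<delta> \<le> 1 \<longrightarrow> t \<in> {-1..1} \<longrightarrow> \<bar>K \<delta> t - K 0 t\<bar> < e"
proof -
  have "uniformly_continuous_on ({0..1} \<times> {-1..1}) (\<lambda>p. K (fst p) (snd p))"
    using assms(1) by (intro compact_uniformly_continuous compact_Times) auto
  then obtain d where "d > 0" and d: "\<And>x x'. x \<in> {0..1} \<times> {-1..1} \<Longrightarrow> x' \<in> {0..1} \<times> {-1..1} \<Longrightarrow> dist x' x < d \<Longrightarrow>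
      dist (K (fst x') (snd x')) (K (fst x) (snd x)) < e"
    using \<open>e > 0\<close> unfolding uniformly_continuous_on_def by metis
  show ?thesis
  proof (intro exI[of _ d] conjI \<open>d > 0\<close> allI impI)
    fix \<delta> t :: real assume "0 \<le> \<delta>" "\<delta> < d" "\<delta> \<le> 1" "t \<in> {-1..1}"
    then show "\<bar>K \<delta> t - K 0 t\<bar> < e"
      using d[of "(0, t)" "(\<delta>, t)"] by (simp add: dist_Pair_Pair dist_real_def)
  qed
qed

text \<open>The gauge is the maximum of two seminorms: the length of the component orthogonal to the
  axis, and a third of the length of the axial component.\<close>

lemma convex_on_revolve_cyl:
  fixes e :: "'a::euclidean_space"
  assumes e: "norm e = 1"
  shows "convex_on UNIV (revolve e cyl)"
proof -
  have ee: "e \<bullet> e = 1" using e by (simp add: norm_eq_1)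
  have eq: "revolve e cyl z = max (norm (z - (z \<bullet> e) *\<^sub>R e)) (\<bar>z \<bullet> e\<bar> / 3)" for z
  proof (cases "z = 0")
    case False
    have "(norm (z - (z \<bullet> e) *\<^sub>R e))\<^sup>2 = (norm z)\<^sup>2 - (z \<bullet> e)\<^sup>2"
      unfolding power2_norm_eq_inner by (simp add: inner_diff ee inner_commute power2_eq_square)
    also have "\<dots> = (norm z)\<^sup>2 * (1 - ((z \<bullet> e) / norm z)\<^sup>2)"
      using False by (simp add: power_divide right_diff_distrib)
    finally have "norm (z - (z \<bullet> e) *\<^sub>R e) = sqrt ((norm z)\<^sup>2 * (1 - ((z \<bullet> e) / norm z)\<^sup>2))"
      by (metis norm_ge_zero real_sqrt_unique)
    then have "norm (z - (z \<bullet> e) *\<^sub>R e) = norm z * sqrt (1 - ((z \<bullet> e) / norm z)\<^sup>2)"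
      by (simp add: real_sqrt_mult)
    then show ?thesis using False by (simp add: revolve_def cyl_def max_mult_distrib_left)
  qed simp
  show ?thesis
  proof (rule convex_onI)
    fix t :: real and x y :: 'a
    assume t: "0 < t" "t < 1"
    let ?z = "(1 - t) *\<^sub>R x + t *\<^sub>R y"
    let ?p = "\<lambda>z. z - (z \<bullet> e) *\<^sub>R e"
    have "norm (?p ?z) = norm ((1 - t) *\<^sub>R ?p x + t *\<^sub>R ?p y)"
      by (simp add: inner_add_left algebra_simps)
    also have "\<dots> \<le> (1 - t) * norm (?p x) + t * norm (?p y)"
      using norm_triangle_ineq[of "(1 - t) *\<^sub>R ?p x" "t *\<^sub>R ?p y"] t by simp
    also have "\<dots> \<le> (1 - t) * revolve e cyl x + t * revolve e cyl y"
      using t by (intro add_mono mult_left_mono) (auto simp: eq)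
    finally have 1: "norm (?p ?z) \<le> (1 - t) * revolve e cyl x + t * revolve e cyl y" .
    have "\<bar>?z \<bullet> e\<bar> / 3 \<le> (1 - t) * (\<bar>x \<bullet> e\<bar> / 3) + t * (\<bar>y \<bullet> e\<bar> / 3)"
      using abs_triangle_ineq[of "(1 - t) * (x \<bullet> e)" "t * (y \<bullet> e)"] t
      by (simp add: inner_add_left abs_mult)
    also have "\<dots> \<le> (1 - t) * revolve e cyl x + t * revolve e cyl y"
      using t by (intro add_mono mult_left_mono) (auto simp: eq)
    finally show "revolve e cyl ?z \<le> (1 - t) * revolve e cyl x + t * revolve e cyl y"
      using 1 by (simp add: eq[of ?z])
  qed simp
qed

lemma revolve_add: "revolve e (\<lambda>t. \<nu> t + \<mu> t) z = revolve e \<nu> z + revolve e \<mu> z"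
  and revolve_const: "revolve e (\<lambda>t. c) z = c * norm z"
  by (simp_all add: revolve_def algebra_simps)

text \<open>\<open>\<phi>\<close> is close to \<open>cyl^(m+1) (quartic m + const)\<close>, so that decreasing the radial function of the
  cylinder along \<open>\<phi>\<close> decreases all sections but increases the volume to first order.\<close>
lemma exists_polynomial_direction:
  assumes "m \<ge> 4"
  obtains \<phi> c where "real_polynomial_function \<phi>" "\<And>t. \<phi> (- t) = \<phi> t" "c > 0"
    "\<And>t. t \<in> {-1..1} \<Longrightarrow> quartic m t + c \<le> \<phi> t / cyl t ^ (m + 1)"
    "(\<integral>v. \<phi> (slope v) / cyl (slope v) ^ (m + 2) / hyp v ^ (m + 1) \<partial>lborel) < 0"
proof -
  define J where "J = (\<integral>v. quartic m (slope v) / cyl (slope v) / hyp v ^ (m + 1) \<partial>lborel)"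
  define W where "W = (\<integral>v. 1 / hyp v ^ (m + 1) \<partial>lborel)"
  have "J < 0" unfolding J_def using assms by (rule integral_quartic_cyl_neg)
  have "W \<ge> 0" unfolding W_def using hyp_pos by (intro integral_nonneg_AE) (auto simp: less_imp_le)
  \<comment> \<open>The quotient of \<phi> by \<open>cyl t ^ (m + 1)\<close> will exceed the quartic
    by at most 3c. Division by one more factor \<open>cyl t \<ge> 1 / 4\<close> makes this 12c, so
    the integral grows by at most 12 c W \<le> - J / 2. Using \<open>W + 1\<close> keeps the
    denominator positive when only \<open>W \<ge> 0\<close> is known.\<close>
  define c where "c = - J / (24 * (W + 1))"
  have "c > 0" unfolding c_def using \<open>J < 0\<close> \<open>W \<ge> 0\<close> by (intro divide_pos_pos) auto
  define F where "F = (\<lambda>t. cyl t ^ (m + 1) * (quartic m t + 2 * c))"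
  have "continuous_on {-1..1} F"
    unfolding F_def by (intro continuous_intros continuous_cyl continuous_quartic)
  \<comment> \<open>This tolerance is at most c \<open>cyl t ^ (m + 1)\<close>, so the offset 2c in
    \<open>F\<close> becomes one between c and 3c after division.\<close>
  moreover have "0 < c * (1 / 4) ^ (m + 1)" using \<open>c > 0\<close> by simp
  ultimately obtain p where p: "real_polynomial_function p"
      and pF: "\<And>t. t \<in> {-1..1} \<Longrightarrow> \<bar>F t - p t\<bar> < c * (1 / 4) ^ (m + 1)"
    using Stone_Weierstrass_real_polynomial_function[OF compact_Icc] by metis
  \<comment> \<open>Averaging with the reflection makes the polynomial even, as origin symmetry of
    the body demands. Since \<open>F\<close> is even, the approximation error does not grow.\<close>
  define \<phi> where "\<phi> = (\<lambda>t. (1 / 2) * (p t + p (- t)))"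
  have "polynomial_function (\<lambda>t::real. - t)"
    by (intro polynomial_function_minus) (simp add: polynomial_function_id[unfolded id_def])
  then have "real_polynomial_function (\<lambda>t. p (- t))"
    using real_polynomial_function_compose[OF _ p] by (simp add: comp_def)
  then have poly: "real_polynomial_function \<phi>"
    unfolding \<phi>_def by (intro real_polynomial_function.intros(2-4) p)
  then have cont: "continuous_on S \<phi>" for S
    using continuous_on_polymonial_function by (auto simp: real_polynomial_function_eq)
  have cyl_pos: "cyl t > 0" for t using cyl_ge[of t] by linarith
  have close: "quartic m t + c \<le> \<phi> t / cyl t ^ (m + 1)" "\<phi> t / cyl t ^ (m + 1) \<le> quartic m t + 3 * c"
    if t: "t \<in> {-1..1}" for t
  proof -
    have "F (- t) = F t" by (simp add: F_def cyl_minus quartic_minus)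
    moreover have "\<bar>F (- t) - p (- t)\<bar> < c * (1 / 4) ^ (m + 1)" using t by (intro pF) auto
    moreover have "\<bar>x - (1 / 2) * (y + z)\<bar> \<le> r" if "\<bar>x - y\<bar> < r" "\<bar>x - z\<bar> < r" for x y z r :: real
      using that unfolding abs_le_iff abs_less_iff by (auto simp: field_simps)
    ultimately have "\<bar>F t - \<phi> t\<bar> \<le> c * (1 / 4) ^ (m + 1)"
      using pF[OF t] unfolding \<phi>_def by metis
    also have "\<dots> \<le> c * cyl t ^ (m + 1)"
      using \<open>c > 0\<close> cyl_ge[of t] by (intro mult_left_mono power_mono) auto
    finally show "quartic m t + c \<le> \<phi> t / cyl t ^ (m + 1)" "\<phi> t / cyl t ^ (m + 1) \<le> quartic m t + 3 * c"
      using cyl_pos[of t] unfolding F_def by (simp_all add: pos_le_divide_eq pos_divide_le_eq abs_le_iff algebra_simps)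
  qed
  have int1: "integrable lborel (\<lambda>v. (quartic m (slope v) / cyl (slope v)) / hyp v ^ (m + 1))"
    using assms cyl_pos
    by (intro integrable_continuous_div_hyp[where f = "\<lambda>t. quartic m t / cyl t"] continuous_intros continuous_cyl continuous_quartic)
      (auto simp: less_imp_neq[THEN not_sym])
  have int2: "integrable lborel (\<lambda>v. (\<phi> (slope v) / cyl (slope v) ^ (m + 2)) / hyp v ^ (m + 1))"
    using assms cyl_pos
    by (intro integrable_continuous_div_hyp[where f = "\<lambda>t. \<phi> t / cyl t ^ (m + 2)"] continuous_intros continuous_cyl cont)
      (auto simp: less_imp_neq[THEN not_sym])
  have int3: "integrable lborel (\<lambda>v. 1 / hyp v ^ (m + 1))"
    using assms by (intro integrable_inverse_hyp_power) auto
  have "(\<integral>v. \<phi> (slope v) / cyl (slope v) ^ (m + 2) / hyp v ^ (m + 1) \<partial>lborel) \<le>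
      (\<integral>v. quartic m (slope v) / cyl (slope v) / hyp v ^ (m + 1) + 12 * c * (1 / hyp v ^ (m + 1)) \<partial>lborel)"
  proof (rule integral_mono)
    fix v :: real
    define t where "t = slope v"
    have "\<phi> t / cyl t ^ (m + 2) = \<phi> t / cyl t ^ (m + 1) / cyl t" by simp
    also have "\<dots> \<le> (quartic m t + 3 * c) / cyl t"
      using cyl_pos[of t] close(2)[of t] slope_in by (intro divide_right_mono) (auto simp: t_def)
    also have "\<dots> \<le> quartic m t / cyl t + 12 * c"
    proof -
      have "3 * c \<le> 12 * c * cyl t" using \<open>c > 0\<close> cyl_ge[of t] by simp
      then have "3 * c / cyl t \<le> 12 * c" using cyl_pos[of t] by (simp add: pos_divide_le_eq)
      then show ?thesis by (simp add: add_divide_distrib)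
    qed
    finally have "\<phi> t / cyl t ^ (m + 2) / hyp v ^ (m + 1) \<le> (quartic m t / cyl t + 12 * c) / hyp v ^ (m + 1)"
      using hyp_pos[of v] by (intro divide_right_mono) auto
    then show "\<phi> (slope v) / cyl (slope v) ^ (m + 2) / hyp v ^ (m + 1) \<le>
        quartic m (slope v) / cyl (slope v) / hyp v ^ (m + 1) + 12 * c * (1 / hyp v ^ (m + 1))"
      by (simp add: t_def add_divide_distrib)
  qed (intro Bochner_Integration.integrable_add integrable_mult_right int1 int2 int3)+
  also have "\<dots> = J + 12 * c * W"
    unfolding J_def W_def
    by (simp only: Bochner_Integration.integral_add[OF int1 integrable_mult_right[OF int3]] integral_mult_right_zero)
  also have "\<dots> < 0"
  proof -
    have "12 * c * W \<le> 12 * c * (W + 1)" using \<open>c > 0\<close> by simp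
    also have "\<dots> = - J / 2" unfolding c_def using \<open>W \<ge> 0\<close> by (simp add: field_simps)
    finally show ?thesis using \<open>J < 0\<close> by linarith
  qed
  finally show ?thesis
    using that[OF poly _ \<open>c > 0\<close> close(1)] by (simp add: \<phi>_def add.commute)
qed

section \<open>Passing to the curved metrics\<close>

text \<open>By homogeneity the inequality says \<open>N (proj_model d x) \<le> \<eta>\<close>: in
  the projective model the body is the Euclidean body of gauge N scaled by \<eta>. Geodesics are
  straight there, so convexity of N becomes geodesic convexity.\<close>

definition curved_body :: "real \<Rightarrow> ('a::euclidean_space \<Rightarrow> real) \<Rightarrow> real \<Rightarrow> 'a set" where
  "curved_body d N \<eta> = {x \<in> ball 0 1. 2 * N x \<le> \<eta> * (1 - d * (norm x)\<^sup>2)}"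

lemma measure_sublevel_scale:
  fixes N :: "'a::euclidean_space \<Rightarrow> real"
  assumes [measurable]: "N \<in> borel_measurable borel"
    and hom: "\<And>c x. c > 0 \<Longrightarrow> N (c *\<^sub>R x) = c * N x" and "c > 0"
  shows "measure lborel {x. N x \<le> c} = c ^ DIM('a) * measure lborel {x. N x \<le> 1}"
proof -
  have "emeasure lborel {x. N x \<le> c} = (\<integral>\<^sup>+x. indicator {x. N x \<le> c} x \<partial>lborel)"
    by simp
  also have "\<dots> = ennreal (\<bar>c\<bar> ^ DIM('a)) * (\<integral>\<^sup>+x. indicator {x. N x \<le> c} (c *\<^sub>R x) \<partial>lborel)"
    using \<open>c > 0\<close> by (intro nn_integral_lborel_scaleR) auto
  also have "(\<integral>\<^sup>+x. indicator {x. N x \<le> c} (c *\<^sub>R x) \<partial>lborel) = (\<integral>\<^sup>+x. indicator {x. N x \<le> 1} x \<partial>lborel)"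
    using \<open>c > 0\<close> by (intro nn_integral_cong) (auto simp: indicator_def hom)
  finally show ?thesis using \<open>c > 0\<close> by (simp add: measure_def enn2real_mult)
qed

text \<open>The constants a and b survive composition with a linear isometry, so the estimates below
  hold with the same constants for both bodies and for all their central sections.\<close>

locale norm_like =
  fixes N :: "'a::euclidean_space \<Rightarrow> real" and a b :: real
  assumes cont: "continuous_on UNIV N"
    and hom: "\<And>c x. c > 0 \<Longrightarrow> N (c *\<^sub>R x) = c * N x"
    and a_pos: "a > 0"
    and lower: "\<And>x. a * norm x \<le> N x"
    and upper: "\<And>x. N x \<le> b * norm x"
begin

lemma borel [measurable]: "N \<in> borel_measurable borel"
  using cont by (rule borel_measurable_continuous_onI)

lemma sublevel_subset_cball: "{x. N x \<le> c} \<subseteq> cball 0 (c / a)"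
proof
  fix x assume "x \<in> {x. N x \<le> c}"
  then have "a * norm x \<le> c" using lower[of x] by simp
  then show "x \<in> cball 0 (c / a)" using a_pos by (simp add: field_simps)
qed

lemma compact_sublevel: "compact {x. N x \<le> c}"
proof -
  have "closed {x. N x \<le> c}" by (intro closed_Collect_le cont continuous_intros)
  then show ?thesis
    using sublevel_subset_cball bounded_subset[OF bounded_cball] by (simp add: compact_eq_bounded_closed) blast
qed

lemma b_pos: "b > 0"
proof -
  obtain e :: 'a where "e \<in> Basis" using nonempty_Basis by blast
  then show ?thesis using lower[of e] upper[of e] a_pos by simp
qed

context
  fixes d \<eta> :: real
  assumes d: "d = 1 \<or> d = -1" and \<eta>: "0 < \<eta>" "2 * \<eta> \<le> a"
begin

lemma d_norm_bounds: "- (norm x)\<^sup>2 \<le> d * (norm x)\<^sup>2" "d * (norm x)\<^sup>2 \<le> (norm x)\<^sup>2" for x :: 'a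
  using d by auto

text \<open>Since 1 - d |x|^2 \<le> 2 on the unit ball, the body lies in N x \<le> \<eta>. The
  condition 2 \<eta> \<le> a keeps it within radius 1/2, away from the unit sphere, where the
  hyperbolic metric blows up.\<close>

lemma norm_curved_body:
  assumes "x \<in> curved_body d N \<eta>"
  shows "norm x \<le> \<eta> / a" "norm x \<le> 1 / 2"
proof -
  have "norm x < 1" "2 * N x \<le> \<eta> * (1 - d * (norm x)\<^sup>2)" using assms by (auto simp: curved_body_def)
  moreover have "(norm x)\<^sup>2 \<le> 1" using \<open>norm x < 1\<close> by (simp add: power_le_one)
  then have "1 - d * (norm x)\<^sup>2 \<le> 2" using d_norm_bounds[of x] by linarith
  then have "\<eta> * (1 - d * (norm x)\<^sup>2) \<le> \<eta> * 2" using \<eta> by (intro mult_left_mono) auto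
  ultimately have "a * norm x \<le> \<eta>" using lower[of x] by simp
  then show 1: "norm x \<le> \<eta> / a" using a_pos by (simp add: field_simps)
  have "\<eta> / a \<le> 1 / 2" using \<eta> a_pos by (simp add: field_simps)
  with 1 show "norm x \<le> 1 / 2" by linarith
qed

lemma compact_curved_body: "compact (curved_body d N \<eta>)"
proof -
  have "curved_body d N \<eta> = cball 0 (1 / 2) \<inter> {x. 2 * N x \<le> \<eta> * (1 - d * (norm x)\<^sup>2)}"
    using norm_curved_body(2) by (auto simp: curved_body_def)
  moreover have "closed {x. 2 * N x \<le> \<eta> * (1 - d * (norm x)\<^sup>2)}"
    by (intro closed_Collect_le continuous_intros cont)
  ultimately show ?thesis by (simp add: compact_Int_closed)
qed

lemma is_body_curved_body: "is_body (curved_body d N \<eta>)"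
proof -
  \<comment> \<open>Radius 1/2 ensures 1 - d |x|^2 \<ge> 1/2, and radius \<eta>/(4b) ensures 2 N x
    \<le> \<eta>/2.\<close>
  have "ball 0 (min (1 / 2) (\<eta> / (4 * b))) \<subseteq> curved_body d N \<eta>"
  proof
    fix x :: 'a assume "x \<in> ball 0 (min (1 / 2) (\<eta> / (4 * b)))"
    then have x: "norm x < 1 / 2" "4 * (b * norm x) < \<eta>" using b_pos by (auto simp: field_simps)
    have "(norm x)\<^sup>2 \<le> (1 / 2)\<^sup>2" using x by (intro power_mono) auto
    then have "1 / 2 \<le> 1 - d * (norm x)\<^sup>2" using d_norm_bounds[of x] by (simp add: power2_eq_square)
    then have "\<eta> * (1 / 2) \<le> \<eta> * (1 - d * (norm x)\<^sup>2)" using \<eta> by (intro mult_left_mono) auto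
    then show "x \<in> curved_body d N \<eta>" using x upper[of x] by (simp add: curved_body_def)
  qed
  moreover have "ball (0::'a) (min (1 / 2) (\<eta> / (4 * b))) \<noteq> {}" using \<eta> b_pos by (simp add: not_le)
  ultimately have "interior (curved_body d N \<eta>) \<noteq> {}"
    by (metis interior_maximal open_ball subset_empty)
  then show ?thesis using compact_curved_body by (auto simp: is_body_def curved_body_def)
qed

lemma one_minus_pos: "norm x < 1 \<Longrightarrow> 0 < 1 - d * (norm x)\<^sup>2" for x :: 'a
  using d_norm_bounds[of x] power_less_one_iff[of "norm x" 2] by simp

lemma geod_convex_curved_body:
  assumes "convex_on UNIV N"
  shows "geod_convex d (curved_body d N \<eta>)"
proof -
  have iff: "x \<in> curved_body d N \<eta> \<longleftrightarrow> N (proj_model d x) \<le> \<eta>" if "norm x < 1" for x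
    using one_minus_pos[OF that] that by (simp add: curved_body_def proj_model_def hom divide_simps)
  show ?thesis
    unfolding geod_convex_def geod_segment_def
  proof (intro ballI subsetI)
    fix p q x
    assume p: "p \<in> curved_body d N \<eta>" and q: "q \<in> curved_body d N \<eta>"
      and x: "x \<in> {x \<in> ball 0 1. proj_model d x \<in> closed_segment (proj_model d p) (proj_model d q)}"
    have "N (proj_model d p) \<le> \<eta>" "N (proj_model d q) \<le> \<eta>"
      using p q iff by (auto simp: curved_body_def)
    moreover have "convex {y. N y \<le> \<eta>}"
    proof (rule convexI)
      fix y z :: 'a and u v :: real
      assume *: "y \<in> {y. N y \<le> \<eta>}" "z \<in> {y. N y \<le> \<eta>}" "0 \<le> u" "0 \<le> v" "u + v = 1"
      then have "N (u *\<^sub>R y + v *\<^sub>R z) \<le> u * N y + v * N z"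
        using assms by (simp add: convex_on_def)
      also have "\<dots> \<le> \<eta>" using * by (intro convex_bound_le) auto
      finally show "u *\<^sub>R y + v *\<^sub>R z \<in> {y. N y \<le> \<eta>}" by simp
    qed
    ultimately have "closed_segment (proj_model d p) (proj_model d q) \<subseteq> {y. N y \<le> \<eta>}"
      by (simp add: closed_segment_subset)
    then show "x \<in> curved_body d N \<eta>" using x iff by auto
  qed
qed

text \<open>On the body |x| \<le> r, so both 1 + d |x|^2 in the density and 1 - d |x|^2 in the
  defining inequality lie between 1 - r^2 and 1 + r^2. Their combined distortion is at most q per
  dimension, and the factor 2 of the metric cancels the 2 in 2 N x.\<close>

lemma rvol_curved_body:
  defines "r \<equiv> \<eta> / a"
  defines "q \<equiv> (1 + r\<^sup>2) / (1 - r\<^sup>2)"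
  shows "rvol d DIM('a) (curved_body d N \<eta>) \<le> (\<eta> * q) ^ DIM('a) * measure lborel {x. N x \<le> 1}"
    and "(\<eta> / q) ^ DIM('a) * measure lborel {x. N x \<le> 1} \<le> rvol d DIM('a) (curved_body d N \<eta>)"
proof -
  let ?m = "DIM('a)" and ?S = "curved_body d N \<eta>"
  define F where "F = (\<lambda>x::'a. 1 / (1 + d * (norm x)\<^sup>2) ^ ?m)"
  have r: "0 < r" "r \<le> 1 / 2" using \<eta> a_pos by (auto simp: r_def field_simps)
  have r2: "0 < r\<^sup>2" "r\<^sup>2 \<le> 1 / 4"
    using r power_mono[of r "1 / 2" 2] by (auto simp: power2_eq_square)
  have x2: "(norm x)\<^sup>2 \<le> r\<^sup>2" if "x \<in> ?S" for x
    using norm_curved_body(1)[OF that] by (simp add: r_def power_mono)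
  have F: "1 / (1 + r\<^sup>2) ^ ?m \<le> F x" "F x \<le> 1 / (1 - r\<^sup>2) ^ ?m" if "x \<in> ?S" for x
  proof -
    have *: "1 - r\<^sup>2 \<le> 1 + d * (norm x)\<^sup>2" "1 + d * (norm x)\<^sup>2 \<le> 1 + r\<^sup>2"
      using x2[OF that] d_norm_bounds[of x] by linarith+
    have "0 < 1 - r\<^sup>2" using r2 by simp
    then show "1 / (1 + r\<^sup>2) ^ ?m \<le> F x" "F x \<le> 1 / (1 - r\<^sup>2) ^ ?m"
      unfolding F_def using * by (auto intro!: divide_left_mono power_mono mult_pos_pos zero_less_power)
  qed
  have [measurable]: "?S \<in> sets borel" using compact_curved_body by (simp add: compact_imp_closed borel_closed)
  have fin: "emeasure lborel ?S < \<infinity>" using compact_curved_body emeasure_compact_finite by (auto simp: top.not_eq_extremum)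
  have one: "((\<lambda>x. 1) has_integral measure lborel ?S) ?S"
    by (rule has_integral_measure_lborel) (use fin in auto)
  have const: "((\<lambda>x. k) has_integral k * measure lborel ?S) ?S" for k
    using has_integral_mult_right[OF one, of k] by simp
  have "continuous_on ?S F"
    unfolding F_def
  proof (intro continuous_intros ballI)
    fix x assume "x \<in> ?S"
    then have "1 - r\<^sup>2 \<le> 1 + d * (norm x)\<^sup>2"
      using x2[of x] d_norm_bounds[of x] by simp
    then show "(1 + d * (norm x)\<^sup>2) ^ ?m \<noteq> 0" using r2 by simp
  qed
  then have int: "F integrable_on ?S"
    using borel_integrable_compact[OF compact_curved_body, of F]
    by (intro set_borel_integral_eq_integral(1)) (simp add: set_integrable_def)
  have up: "integral ?S F \<le> (1 / (1 - r\<^sup>2) ^ ?m) * measure lborel ?S"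
    using has_integral_le[OF integrable_integral[OF int] const] F by blast
  have lo: "(1 / (1 + r\<^sup>2) ^ ?m) * measure lborel ?S \<le> integral ?S F"
    using has_integral_le[OF const integrable_integral[OF int]] F by blast
  let ?c1 = "\<eta> * (1 + r\<^sup>2) / 2" and ?c2 = "\<eta> * (1 - r\<^sup>2) / 2"
  have "?S \<subseteq> {x. N x \<le> ?c1}"
  proof
    fix x assume x: "x \<in> ?S"
    then have "1 - d * (norm x)\<^sup>2 \<le> 1 + r\<^sup>2" using x2[OF x] d_norm_bounds[of x] by linarith
    then have "\<eta> * (1 - d * (norm x)\<^sup>2) \<le> \<eta> * (1 + r\<^sup>2)" using \<eta> by (intro mult_left_mono) auto
    then show "x \<in> {x. N x \<le> ?c1}" using x by (simp add: curved_body_def)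
  qed
  moreover have "emeasure lborel {x. N x \<le> ?c1} \<noteq> \<infinity>"
    using emeasure_compact_finite[OF compact_sublevel[of ?c1]] by auto
  ultimately have "measure lborel ?S \<le> measure lborel {x. N x \<le> ?c1}"
    by (intro measure_mono_fmeasurable fmeasurableI) (auto simp: top.not_eq_extremum)
  also have "\<dots> = ?c1 ^ ?m * measure lborel {x. N x \<le> 1}"
    using \<eta> by (intro measure_sublevel_scale borel hom) (auto intro!: mult_pos_pos add_pos_nonneg)
  finally have 1: "measure lborel ?S \<le> ?c1 ^ ?m * measure lborel {x. N x \<le> 1}" .
  have "rvol d ?m ?S \<le> 2 ^ ?m * ((1 / (1 - r\<^sup>2) ^ ?m) * (?c1 ^ ?m * measure lborel {x. N x \<le> 1}))"
    unfolding rvol_def F_def[symmetric] using r2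
    by (intro mult_left_mono order_trans[OF up] 1) auto
  also have "\<dots> = (\<eta> * q) ^ ?m * measure lborel {x. N x \<le> 1}"
    by (simp add: q_def power_mult_distrib power_divide)
  finally show "rvol d ?m ?S \<le> (\<eta> * q) ^ ?m * measure lborel {x. N x \<le> 1}" .
  have "{x. N x \<le> ?c2} \<subseteq> ?S"
  proof
    fix x assume x: "x \<in> {x. N x \<le> ?c2}"
    have "?c2 / a \<le> r" using \<eta> a_pos by (auto simp: r_def field_simps)
    moreover have "norm x \<le> ?c2 / a" using x sublevel_subset_cball[of ?c2] by auto
    ultimately have nx: "norm x \<le> r" by linarith
    then have "(norm x)\<^sup>2 \<le> r\<^sup>2" by (simp add: power_mono)
    then have "1 - r\<^sup>2 \<le> 1 - d * (norm x)\<^sup>2" using d_norm_bounds[of x] by linarith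
    then have "\<eta> * (1 - r\<^sup>2) \<le> \<eta> * (1 - d * (norm x)\<^sup>2)" using \<eta> by (intro mult_left_mono) auto
    then show "x \<in> ?S" using x nx r by (simp add: curved_body_def)
  qed
  then have "measure lborel {x. N x \<le> ?c2} \<le> measure lborel ?S"
    using fin by (intro measure_mono_fmeasurable fmeasurableI) auto
  moreover have "measure lborel {x. N x \<le> ?c2} = ?c2 ^ ?m * measure lborel {x. N x \<le> 1}"
    using \<eta> r2 by (intro measure_sublevel_scale borel hom) auto
  ultimately have 2: "?c2 ^ ?m * measure lborel {x. N x \<le> 1} \<le> measure lborel ?S" by simp
  have "(\<eta> / q) ^ ?m * measure lborel {x. N x \<le> 1} = 2 ^ ?m * ((1 / (1 + r\<^sup>2) ^ ?m) * (?c2 ^ ?m * measure lborel {x. N x \<le> 1}))"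
    by (simp add: q_def power_mult_distrib power_divide)
  also have "\<dots> \<le> rvol d ?m ?S"
    unfolding rvol_def F_def[symmetric]
    by (intro mult_left_mono order_trans[OF _ lo] 2) auto
  finally show "(\<eta> / q) ^ ?m * measure lborel {x. N x \<le> 1} \<le> rvol d ?m ?S" .
qed

end

lemma norm_like_compose:
  fixes f :: "'b::euclidean_space \<Rightarrow> 'a"
  assumes "linear f" "\<And>t. norm (f t) = norm t"
  shows "norm_like (N \<circ> f) a b"
proof
  show "continuous_on UNIV (N \<circ> f)"
    using \<open>linear f\<close> by (intro continuous_on_compose continuous_on_subset[OF cont])
      (auto simp: linear_continuous_on linear_conv_bounded_linear)
qed (use assms lower upper a_pos in \<open>auto simp: hom linear_cmul\<close>, metis lower assms(2), metis upper assms(2))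

end

lemma vimage_curved_body:
  assumes "\<And>t. norm (f t) = norm t"
  shows "f -` curved_body d N \<eta> = curved_body d (N \<circ> f) \<eta>"
  by (auto simp: curved_body_def assms)

text \<open>Near the origin both metrics are almost a constant multiple of the Euclidean one, so strict
  Euclidean inequalities survive scaling by a small \<open>\<eta>\<close>.\<close>
lemma euclidean_counterexample_imp_curved:
  fixes N\<^sub>K N\<^sub>L :: "'a::euclidean_space \<Rightarrow> real"
  assumes d: "d = 1 \<or> d = -1"
    and norm_like: "norm_like N\<^sub>K a b" "norm_like N\<^sub>L a b"
    and convex: "convex_on UNIV N\<^sub>K" "convex_on UNIV N\<^sub>L"
    and even: "\<And>x. N\<^sub>K (- x) = N\<^sub>K x" "\<And>x. N\<^sub>L (- x) = N\<^sub>L x"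
    and vol: "measure lborel {x. N\<^sub>L x \<le> 1} < measure lborel {x. N\<^sub>K x \<le> 1}"
    and "\<kappa> > 0"
    and sections: "\<And>f :: 'b::euclidean_space \<Rightarrow> 'a. linear f \<Longrightarrow> (\<And>t. norm (f t) = norm t) \<Longrightarrow>
      measure lborel {t. N\<^sub>K (f t) \<le> 1} + \<kappa> \<le> measure lborel {t. N\<^sub>L (f t) \<le> 1}"
  shows "\<exists>K L :: 'a set.
           is_body K \<and> is_body L \<and> geod_convex d K \<and> geod_convex d L
         \<and> origin_symmetric K \<and> origin_symmetric L
         \<and> (\<forall>(f :: 'b \<Rightarrow> 'a) xi. hyperplane_param f xi \<longrightarrow>
                rvol d DIM('b) (f -` K) \<le> rvol d DIM('b) (f -` L))
         \<and> rvol d DIM('a) K > rvol d DIM('a) L"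
proof -
  interpret K: norm_like N\<^sub>K a b by fact
  interpret L: norm_like N\<^sub>L a b by fact
  let ?n = "DIM('a)" and ?m = "DIM('b)"
  define q where "q = (\<lambda>\<eta>. (1 + (\<eta> / a)\<^sup>2) / (1 - (\<eta> / a)\<^sup>2))"
  \<comment> \<open>A bound for all sections of L at once. It turns the additive gap \<kappa> into
    the factor 1 - \<kappa>/C, which for small \<eta> outweighs the distortion uniformly in the
    hyperplane; the summand \<kappa> makes \<open>C\<close> positive outright.\<close>
  define C where "C = measure lborel (cball (0::'b) (1 / a)) + \<kappa>"
  have "C > 0" unfolding C_def using \<open>\<kappa> > 0\<close> by (intro add_nonneg_pos) auto
  have sectL: "measure lborel {t. N\<^sub>L (f t) \<le> 1} \<le> C"
    if "linear f" "\<And>t. norm (f t) = norm t" for f :: "'b \<Rightarrow> 'a"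
  proof -
    interpret f: norm_like "N\<^sub>L \<circ> f" a b by (rule L.norm_like_compose) (use that in auto)
    have "measure lborel {t. (N\<^sub>L \<circ> f) t \<le> 1} \<le> measure lborel (cball (0::'b) (1 / a))"
      using f.sublevel_subset_cball[of 1] emeasure_compact_finite[OF compact_cball[of "0::'b" "1 / a"]]
      by (intro measure_mono_fmeasurable fmeasurableI)
        (auto simp: borel_closed f.compact_sublevel[unfolded comp_def] compact_imp_closed)
    then show ?thesis using \<open>\<kappa> > 0\<close> by (simp add: C_def)
  qed
  have q1: "(q \<longlongrightarrow> 1) (at_right 0)"
    unfolding q_def using K.a_pos by (auto intro!: tendsto_eq_intros)
  have "((\<lambda>\<eta>. q \<eta> ^ (2 * ?m) * (1 - \<kappa> / C)) \<longlongrightarrow> 1 ^ (2 * ?m) * (1 - \<kappa> / C)) (at_right 0)"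
    by (intro tendsto_intros q1)
  then have ev1: "eventually (\<lambda>\<eta>. q \<eta> ^ (2 * ?m) * (1 - \<kappa> / C) < 1) (at_right 0)"
    using \<open>\<kappa> > 0\<close> \<open>C > 0\<close> by (intro order_tendstoD(2)) auto
  have "((\<lambda>\<eta>. q \<eta> ^ (2 * ?n) * measure lborel {x. N\<^sub>L x \<le> 1}) \<longlongrightarrow> 1 ^ (2 * ?n) * measure lborel {x. N\<^sub>L x \<le> 1}) (at_right 0)"
    by (intro tendsto_intros q1)
  then have ev2: "eventually (\<lambda>\<eta>. q \<eta> ^ (2 * ?n) * measure lborel {x. N\<^sub>L x \<le> 1} < measure lborel {x. N\<^sub>K x \<le> 1}) (at_right 0)"
    using vol by (intro order_tendstoD(2)) auto
  have ev3: "eventually (\<lambda>\<eta>. 0 < \<eta> \<and> 2 * \<eta> \<le> a) (at_right 0)"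
    using K.a_pos by (auto simp: eventually_at_right_field intro!: exI[of _ "a / 2"])
  obtain \<eta> where \<eta>: "0 < \<eta>" "2 * \<eta> \<le> a"
    and q_sect: "q \<eta> ^ (2 * ?m) * (1 - \<kappa> / C) < 1"
    and q_vol: "q \<eta> ^ (2 * ?n) * measure lborel {x. N\<^sub>L x \<le> 1} < measure lborel {x. N\<^sub>K x \<le> 1}"
    using eventually_happens'[OF _ eventually_conj[OF ev1 eventually_conj[OF ev2 ev3]]] by auto
  let ?K = "curved_body d N\<^sub>K \<eta>" and ?L = "curved_body d N\<^sub>L \<eta>"
  have q_eq: "q \<eta> = (1 + (\<eta> / a)\<^sup>2) / (1 - (\<eta> / a)\<^sup>2)" by (simp add: q_def)
  have q_pos: "q \<eta> > 0"
  proof -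
    have "\<eta> / a < 1" "0 < \<eta> / a" using \<eta> by auto
    then have "(\<eta> / a)\<^sup>2 < 1" by (simp add: power_less_one_iff del: divide_less_eq_1)
    then show ?thesis unfolding q_def by (intro divide_pos_pos add_pos_nonneg) auto
  qed
  have q_swap: "(\<eta> * q \<eta>) ^ k * A \<le> (\<eta> / q \<eta>) ^ k * B \<longleftrightarrow> q \<eta> ^ (2 * k) * A \<le> B" for A B k
    using \<eta> q_pos by (simp add: power_mult_distrib power_divide field_simps power_mult power2_eq_square)
  have sym: "origin_symmetric (curved_body d N \<eta>)" if "\<And>x. N (- x) = N x" for N :: "'a \<Rightarrow> real"
  proof -
    have "- x \<in> curved_body d N \<eta> \<longleftrightarrow> x \<in> curved_body d N \<eta>" for x by (simp add: curved_body_def that)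
    then show ?thesis unfolding origin_symmetric_def by (auto simp: image_iff) (metis add.inverse_inverse)
  qed
  have sect: "rvol d ?m (f -` ?K) \<le> rvol d ?m (f -` ?L)" if "hyperplane_param f xi" for f :: "'b \<Rightarrow> 'a" and xi
  proof -
    have f: "linear f" "\<And>t. norm (f t) = norm t" using that by (auto simp: hyperplane_param_def)
    interpret fK: norm_like "N\<^sub>K \<circ> f" a b by (rule K.norm_like_compose) (use f in auto)
    interpret fL: norm_like "N\<^sub>L \<circ> f" a b by (rule L.norm_like_compose) (use f in auto)
    let ?vK = "measure lborel {t. N\<^sub>K (f t) \<le> 1}" and ?vL = "measure lborel {t. N\<^sub>L (f t) \<le> 1}"
    have "\<kappa> / C * ?vL \<le> \<kappa>"
      using sectL[OF f] \<open>\<kappa> > 0\<close> \<open>C > 0\<close> by (simp add: field_simps)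
    then have "?vK \<le> (1 - \<kappa> / C) * ?vL" using sections[OF f] by (simp add: algebra_simps)
    then have "q \<eta> ^ (2 * ?m) * ?vK \<le> q \<eta> ^ (2 * ?m) * ((1 - \<kappa> / C) * ?vL)"
      using q_pos by (intro mult_left_mono) auto
    also have "\<dots> \<le> 1 * ?vL"
      using q_sect unfolding mult.assoc[symmetric] by (intro mult_right_mono) auto
    finally have "(\<eta> * q \<eta>) ^ ?m * ?vK \<le> (\<eta> / q \<eta>) ^ ?m * ?vL" by (simp add: q_swap)
    then show ?thesis
      using fK.rvol_curved_body(1)[OF d \<eta>, folded q_eq] fL.rvol_curved_body(2)[OF d \<eta>, folded q_eq]
      by (simp add: vimage_curved_body[OF f(2)] comp_def)
  qed
  have "(\<eta> * q \<eta>) ^ ?n * measure lborel {x. N\<^sub>L x \<le> 1} < (\<eta> / q \<eta>) ^ ?n * measure lborel {x. N\<^sub>K x \<le> 1}"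
    using q_vol q_swap[of ?n "measure lborel {x. N\<^sub>K x \<le> 1}" "measure lborel {x. N\<^sub>L x \<le> 1}"] 
      \<eta> q_pos by (simp add: power_mult_distrib power_divide field_simps power_mult power2_eq_square)
  then have "rvol d ?n ?L < rvol d ?n ?K"
    using L.rvol_curved_body(1)[OF d \<eta>, folded q_eq] K.rvol_curved_body(2)[OF d \<eta>, folded q_eq]
    by simp
  with sect show ?thesis
    using K.is_body_curved_body[OF d \<eta>] L.is_body_curved_body[OF d \<eta>]
      K.geod_convex_curved_body[OF d \<eta> convex(1)] L.geod_convex_curved_body[OF d \<eta> convex(2)]
      sym[of N\<^sub>K, OF even(1)] sym[of N\<^sub>L, OF even(2)]
    by blast
qed

section \<open>The counterexample\<close>

text \<open>The profiles are \<nu> = cyl + \<delta> for L and \<nu> + \<epsilon> \<phi> for K, with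
  \<phi> the polynomial direction and \<epsilon> = \<delta>/M tied to \<delta> by convexity. Both
  strict conditions on \<phi> hold at \<delta> = 0 with room to spare, so they persist for small
  \<delta>.\<close>

lemma exists_convex_profiles:
  fixes e :: "'a::euclidean_space"
  assumes "m \<ge> 4" and e: "norm e = 1"
  obtains \<nu> \<phi> :: "real \<Rightarrow> real" and \<epsilon> c where
    "\<epsilon> > 0" "c > 0" "continuous_on UNIV \<nu>" "continuous_on UNIV \<phi>"
    "\<And>t. \<nu> (- t) = \<nu> t" "\<And>t. \<phi> (- t) = \<phi> t"
    "\<And>t. t \<in> {-1..1} \<Longrightarrow> 1 / 4 \<le> \<nu> t \<and> \<nu> t \<le> 3"
    "\<And>t. t \<in> {-1..1} \<Longrightarrow> 1 / 4 \<le> \<nu> t + \<epsilon> * \<phi> t \<and> \<nu> t + \<epsilon> * \<phi> t \<le> 3"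
    "convex_on UNIV (revolve e \<nu>)" "convex_on UNIV (revolve e (\<lambda>t. \<nu> t + \<epsilon> * \<phi> t))"
    "\<And>t. t \<in> {-1..1} \<Longrightarrow> quartic m t + c \<le> \<phi> t / (\<nu> t + \<epsilon> * \<phi> t) ^ (m + 1)"
    "(\<integral>v. \<phi> (slope v) / \<nu> (slope v) ^ (m + 2) / hyp v ^ (m + 1) \<partial>lborel) < 0"
proof -
  obtain \<phi> c where poly: "real_polynomial_function \<phi>" and even: "\<And>t. \<phi> (- t) = \<phi> t" and "c > 0"
    and sect: "\<And>t. t \<in> {-1..1} \<Longrightarrow> quartic m t + c \<le> \<phi> t / cyl t ^ (m + 1)"
    and neg: "(\<integral>v. \<phi> (slope v) / cyl (slope v) ^ (m + 2) / hyp v ^ (m + 1) \<partial>lborel) < 0"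
    using exists_polynomial_direction[OF \<open>m \<ge> 4\<close>] by blast
  have cont: "continuous_on S \<phi>" for S
    using poly continuous_on_polymonial_function by (auto simp: real_polynomial_function_eq)
  obtain M0 where M0: "\<And>M. M \<ge> M0 \<Longrightarrow> convex_on UNIV (revolve e (\<lambda>t. \<phi> t + M))"
    using convex_on_revolve_polynomial[OF e poly] by blast
  have "bounded (\<phi> ` {-1..1})"
    by (intro compact_imp_bounded compact_continuous_image cont compact_Icc)
  then obtain B where B: "\<forall>x\<in>\<phi> ` {-1..1}. norm x \<le> B" unfolding bounded_iff by blast
  \<comment> \<open>\<open>M0\<close> secures convexity. The bound \<open>B\<close> on |\<phi>|
    gives |\<epsilon> \<phi>| \<le> \<delta>, so the perturbed profile never drops below
    \<open>cyl\<close> and, as \<delta> \<le> 1, never exceeds 3.\<close>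
  define M where "M = max 1 (max M0 B)"
  have "M \<ge> 1" "M \<ge> M0" "M \<ge> B" by (simp_all add: M_def)
  have \<phi>_M: "\<bar>\<phi> t / M\<bar> \<le> 1" if "t \<in> {-1..1}" for t
    using B that \<open>M \<ge> 1\<close> \<open>M \<ge> B\<close> by (auto simp: divide_le_eq) (meson atLeastAtMost_iff order_trans)
  define W where "W = (\<integral>v. 1 / hyp v ^ (m + 1) \<partial>lborel)"
  have "W \<ge> 0" unfolding W_def using hyp_pos by (intro integral_nonneg_AE) (auto simp: less_imp_le)
  define J where "J = (\<integral>v. \<phi> (slope v) / cyl (slope v) ^ (m + 2) / hyp v ^ (m + 1) \<partial>lborel)"
  have "J < 0" using neg by (simp add: J_def)
  define r where "r = - J / (2 * (W + 1))"
  have "r > 0" unfolding r_def using \<open>J < 0\<close> \<open>W \<ge> 0\<close> by (intro divide_pos_pos) auto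
  \<comment> \<open>At \<delta> = 0, \<open>K1\<close> and \<open>K2\<close> are the quotients with
    \<open>cyl\<close> alone; at the final \<delta> they are those with \<nu> + \<epsilon> \<phi>
    and with \<nu>. Uniform continuity on a compact square allows changes below c/2 and
    \<open>r\<close>; the latter costs at most half of |J|.\<close>
  define K1 where "K1 = (\<lambda>\<delta> t. \<phi> t / (cyl t + \<delta> + \<delta> / M * \<phi> t) ^ (m + 1))"
  define K2 where "K2 = (\<lambda>\<delta> t. \<phi> t / (cyl t + \<delta>) ^ (m + 2))"
  have den: "1 / 4 \<le> cyl t + \<delta> + \<delta> / M * \<phi> t" "cyl t + \<delta> + \<delta> / M * \<phi> t \<le> 3"
    if "0 \<le> \<delta>" "\<delta> \<le> 1" "t \<in> {-1..1}" for \<delta> t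
  proof -
    have "\<bar>\<delta> * (\<phi> t / M)\<bar> \<le> \<delta> * 1"
      unfolding abs_mult using \<phi>_M[OF that(3)] that(1) by (intro mult_mono) auto
    then show "1 / 4 \<le> cyl t + \<delta> + \<delta> / M * \<phi> t" "cyl t + \<delta> + \<delta> / M * \<phi> t \<le> 3"
      using cyl_ge[of t] cyl_le_1[OF that(3)] that(1,2) unfolding abs_le_iff by simp_all
  qed
  have cont_comp: "continuous_on ({0..1} \<times> {-1..1}) (\<lambda>p::real \<times> real. \<phi> (snd p))"
    "continuous_on ({0..1} \<times> {-1..1}) (\<lambda>p::real \<times> real. cyl (snd p))"
    using continuous_on_compose2[OF cont[of UNIV] continuous_on_snd[OF continuous_on_id]]
      continuous_on_compose2[OF continuous_cyl[of UNIV] continuous_on_snd[OF continuous_on_id]] by auto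
  have "continuous_on ({0..1} \<times> {-1..1}) (\<lambda>p. K1 (fst p) (snd p))"
    unfolding K1_def
  proof (intro continuous_intros cont_comp ballI)
    fix p :: "real \<times> real" assume "p \<in> {0..1} \<times> {-1..1}"
    then have "1 / 4 \<le> cyl (snd p) + fst p + fst p / M * \<phi> (snd p)" by (intro den(1)) auto
    then have "0 < cyl (snd p) + fst p + fst p / M * \<phi> (snd p)" by (rule less_le_trans[rotated]) simp
    then show "(cyl (snd p) + fst p + fst p / M * \<phi> (snd p)) ^ (m + 1) \<noteq> 0"
      by (intro power_not_zero less_imp_neq[THEN not_sym])
    show "M \<noteq> 0" using \<open>M \<ge> 1\<close> by linarith
  qed
  moreover have "0 < c / 2" using \<open>c > 0\<close> by simp
  ultimately have "\<exists>d>0. \<forall>\<delta> t. 0 \<le> \<delta> \<longrightarrow> \<delta> < d \<longrightarrow> \<delta> \<le> 1 \<longrightarrow> t \<in> {-1..1} \<longrightarrow> \<bar>K1 \<delta> t - K1 0 t\<bar> < c / 2"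
    by (rule uniform_limit_parameter)
  then obtain d1 where "d1 > 0" and d1: "\<And>\<delta> t. 0 \<le> \<delta> \<Longrightarrow> \<delta> < d1 \<Longrightarrow> \<delta> \<le> 1 \<Longrightarrow> t \<in> {-1..1} \<Longrightarrow> \<bar>K1 \<delta> t - K1 0 t\<bar> < c / 2"
    by blast
  have "continuous_on ({0..1} \<times> {-1..1}) (\<lambda>p. K2 (fst p) (snd p))"
    unfolding K2_def
  proof (intro continuous_intros cont_comp ballI)
    fix p :: "real \<times> real" assume "p \<in> {0..1} \<times> {-1..1}"
    then have "0 < cyl (snd p) + fst p" using cyl_ge[of "snd p"] by auto
    then show "(cyl (snd p) + fst p) ^ (m + 2) \<noteq> 0"
      by (intro power_not_zero less_imp_neq[THEN not_sym])
  qed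
  then have "\<exists>d>0. \<forall>\<delta> t. 0 \<le> \<delta> \<longrightarrow> \<delta> < d \<longrightarrow> \<delta> \<le> 1 \<longrightarrow> t \<in> {-1..1} \<longrightarrow> \<bar>K2 \<delta> t - K2 0 t\<bar> < r"
    using \<open>r > 0\<close> by (rule uniform_limit_parameter)
  then obtain d2 where "d2 > 0" and d2: "\<And>\<delta> t. 0 \<le> \<delta> \<Longrightarrow> \<delta> < d2 \<Longrightarrow> \<delta> \<le> 1 \<Longrightarrow> t \<in> {-1..1} \<Longrightarrow> \<bar>K2 \<delta> t - K2 0 t\<bar> < r"
    by blast
  define \<delta> where "\<delta> = min 1 (min d1 d2 / 2)"
  have \<delta>: "0 < \<delta>" "\<delta> < d1" "\<delta> < d2" "\<delta> \<le> 1"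
    using \<open>d1 > 0\<close> \<open>d2 > 0\<close> by (auto simp: \<delta>_def min_def)
  define \<nu> where "\<nu> = (\<lambda>t. cyl t + \<delta>)"
  define \<epsilon> where "\<epsilon> = \<delta> / M"
  have "\<epsilon> > 0" using \<delta> \<open>M \<ge> 1\<close> by (simp add: \<epsilon>_def)
  have cont_\<nu>: "continuous_on UNIV \<nu>" unfolding \<nu>_def by (intro continuous_intros continuous_cyl)
  have convex_norm: "convex_on UNIV (\<lambda>z::'a. \<delta> * norm z)"
    using \<delta> convex_on_cmul[OF _ convex_on_dist[of UNIV "0::'a"]] by (simp add: dist_norm)
  have convex1: "convex_on UNIV (revolve e \<nu>)"
    using convex_on_add[OF convex_on_revolve_cyl[OF e] convex_norm]
    by (simp add: \<nu>_def revolve_add[abs_def] revolve_const)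
  have convex2: "convex_on UNIV (revolve e (\<lambda>t. \<nu> t + \<epsilon> * \<phi> t))"
  proof -
    \<comment> \<open>The choice \<epsilon> = \<delta>/M gives \<delta> + \<epsilon> \<phi> =
      \<epsilon> (\<phi> + M), so the added round part is exactly what makes the perturbation
      convex.\<close>
    have "revolve e (\<lambda>t. \<nu> t + \<epsilon> * \<phi> t) z = revolve e cyl z + \<epsilon> * revolve e (\<lambda>t. \<phi> t + M) z" for z
      using \<open>M \<ge> 1\<close> by (simp add: revolve_def \<nu>_def \<epsilon>_def field_simps)
    then have eq: "revolve e (\<lambda>t. \<nu> t + \<epsilon> * \<phi> t) = (\<lambda>z. revolve e cyl z + \<epsilon> * revolve e (\<lambda>t. \<phi> t + M) z)"
      by (rule ext)
    show ?thesis
      unfolding eq using \<open>\<epsilon> > 0\<close>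
      by (intro convex_on_add convex_on_revolve_cyl[OF e] convex_on_cmul M0[OF \<open>M \<ge> M0\<close>]) simp
  qed
  have sect': "quartic m t + c / 2 \<le> \<phi> t / (\<nu> t + \<epsilon> * \<phi> t) ^ (m + 1)" if "t \<in> {-1..1}" for t
  proof -
    have "\<bar>K1 \<delta> t - K1 0 t\<bar> < c / 2" using \<delta> that by (intro d1) auto
    moreover have "K1 0 t = \<phi> t / cyl t ^ (m + 1)" by (simp add: K1_def)
    moreover have "K1 \<delta> t = \<phi> t / (\<nu> t + \<epsilon> * \<phi> t) ^ (m + 1)" by (simp add: K1_def \<nu>_def \<epsilon>_def)
    ultimately show ?thesis using sect[OF that] unfolding abs_less_iff by linarith
  qed
  have \<nu>_ge: "\<nu> t \<ge> 1 / 4" for t using cyl_ge[of t] \<delta> by (simp add: \<nu>_def)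
  have cyl_nz: "cyl t \<noteq> 0" for t using cyl_ge[of t] by auto
  have \<nu>_nz: "\<nu> t \<noteq> 0" for t using \<nu>_ge[of t] by auto
  have int1: "integrable lborel (\<lambda>v. (\<phi> (slope v) / \<nu> (slope v) ^ (m + 2)) / hyp v ^ (m + 1))"
    using assms \<nu>_nz
    by (intro integrable_continuous_div_hyp[where f = "\<lambda>t. \<phi> t / \<nu> t ^ (m + 2)"] continuous_intros cont_\<nu> cont) auto
  have int2: "integrable lborel (\<lambda>v. (\<phi> (slope v) / cyl (slope v) ^ (m + 2)) / hyp v ^ (m + 1))"
    using assms cyl_nz
    by (intro integrable_continuous_div_hyp[where f = "\<lambda>t. \<phi> t / cyl t ^ (m + 2)"] continuous_intros continuous_cyl cont) auto
  have int3: "integrable lborel (\<lambda>v. 1 / hyp v ^ (m + 1))"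
    using assms by (intro integrable_inverse_hyp_power) auto
  have "(\<integral>v. \<phi> (slope v) / \<nu> (slope v) ^ (m + 2) / hyp v ^ (m + 1) \<partial>lborel) \<le>
      (\<integral>v. \<phi> (slope v) / cyl (slope v) ^ (m + 2) / hyp v ^ (m + 1) + r * (1 / hyp v ^ (m + 1)) \<partial>lborel)"
  proof (rule integral_mono)
    fix v :: real
    have "\<phi> (slope v) / \<nu> (slope v) ^ (m + 2) \<le> \<phi> (slope v) / cyl (slope v) ^ (m + 2) + r"
    proof -
      have "\<bar>K2 \<delta> (slope v) - K2 0 (slope v)\<bar> < r" using \<delta> slope_in by (intro d2) auto
      moreover have "K2 0 (slope v) = \<phi> (slope v) / cyl (slope v) ^ (m + 2)" by (simp add: K2_def)
      moreover have "K2 \<delta> (slope v) = \<phi> (slope v) / \<nu> (slope v) ^ (m + 2)" by (simp add: K2_def \<nu>_def)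
      ultimately show ?thesis unfolding abs_less_iff by linarith
    qed
    then have "\<phi> (slope v) / \<nu> (slope v) ^ (m + 2) / hyp v ^ (m + 1) \<le>
        (\<phi> (slope v) / cyl (slope v) ^ (m + 2) + r) / hyp v ^ (m + 1)"
      using hyp_pos[of v] by (intro divide_right_mono) auto
    then show "\<phi> (slope v) / \<nu> (slope v) ^ (m + 2) / hyp v ^ (m + 1) \<le>
        \<phi> (slope v) / cyl (slope v) ^ (m + 2) / hyp v ^ (m + 1) + r * (1 / hyp v ^ (m + 1))"
      by (simp add: add_divide_distrib)
  qed (intro Bochner_Integration.integrable_add integrable_mult_right int1 int2 int3)+
  also have "\<dots> = J + r * W"
    unfolding J_def W_def
    by (simp only: Bochner_Integration.integral_add[OF int2 integrable_mult_right[OF int3]] integral_mult_right_zero)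
  also have "\<dots> < 0"
  proof -
    have "r * W \<le> r * (W + 1)" using \<open>r > 0\<close> by simp
    also have "\<dots> = - J / 2" unfolding r_def using \<open>W \<ge> 0\<close> by (simp add: field_simps)
    finally show ?thesis using \<open>J < 0\<close> by linarith
  qed
  finally have vol: "(\<integral>v. \<phi> (slope v) / \<nu> (slope v) ^ (m + 2) / hyp v ^ (m + 1) \<partial>lborel) < 0" .
  show ?thesis
  proof (rule that[OF \<open>\<epsilon> > 0\<close> _ cont_\<nu> cont _ even _ _ convex1 convex2 sect' vol])
    show "c / 2 > 0" using \<open>c > 0\<close> by simp
    show "\<nu> (- t) = \<nu> t" for t by (simp add: \<nu>_def cyl_minus)
    show "1 / 4 \<le> \<nu> t \<and> \<nu> t \<le> 3" if "t \<in> {-1..1}" for t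
      using \<nu>_ge[of t] cyl_le_1[OF that] \<delta> by (simp add: \<nu>_def)
    show "1 / 4 \<le> \<nu> t + \<epsilon> * \<phi> t \<and> \<nu> t + \<epsilon> * \<phi> t \<le> 3" if "t \<in> {-1..1}" for t
      using den[of \<delta> t] \<delta> that by (simp add: \<nu>_def \<epsilon>_def)
  qed
qed

theorem theorem3:
  fixes d :: real
  assumes "d = 1 \<or> d = -1"
    and "DIM('a::euclidean_space) \<ge> 5"
    and "DIM('b::euclidean_space) + 1 = DIM('a)"
  shows "\<exists>K L :: 'a set.
           is_body K \<and> is_body L \<and> geod_convex d K \<and> geod_convex d L
         \<and> origin_symmetric K \<and> origin_symmetric L
         \<and> (\<forall>(f :: 'b \<Rightarrow> 'a) xi. hyperplane_param f xi \<longrightarrow>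
                rvol d DIM('b) (f -` K) \<le> rvol d DIM('b) (f -` L))
         \<and> rvol d DIM('a) K > rvol d DIM('a) L"
proof -
  let ?m = "DIM('b)" and ?n = "DIM('a)"
  have "?m \<ge> 4" and n: "?n = ?m + 1" using assms by simp_all
  obtain e :: 'a where "e \<in> Basis" using nonempty_Basis by blast
  then have e: "norm e = 1" by simp
  show ?thesis
  proof (rule exists_convex_profiles[OF \<open>?m \<ge> 4\<close> e])
    fix \<nu> \<phi> :: "real \<Rightarrow> real" and \<epsilon> c :: real
    assume "\<epsilon> > 0" "c > 0"
      and cont: "continuous_on UNIV \<nu>" "continuous_on UNIV \<phi>"
      and even: "\<And>t. \<nu> (- t) = \<nu> t" "\<And>t. \<phi> (- t) = \<phi> t"
      and \<nu>: "\<And>t. t \<in> {-1..1} \<Longrightarrow> 1 / 4 \<le> \<nu> t \<and> \<nu> t \<le> 3"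
      and \<nu>\<phi>: "\<And>t. t \<in> {-1..1} \<Longrightarrow> 1 / 4 \<le> \<nu> t + \<epsilon> * \<phi> t \<and> \<nu> t + \<epsilon> * \<phi> t \<le> 3"
      and convex: "convex_on UNIV (revolve e \<nu>)" "convex_on UNIV (revolve e (\<lambda>t. \<nu> t + \<epsilon> * \<phi> t))"
      and sect: "\<And>t. t \<in> {-1..1} \<Longrightarrow> quartic ?m t + c \<le> \<phi> t / (\<nu> t + \<epsilon> * \<phi> t) ^ (?m + 1)"
      and vol: "(\<integral>v. \<phi> (slope v) / \<nu> (slope v) ^ (?m + 2) / hyp v ^ (?m + 1) \<partial>lborel) < 0"
    define \<mu> where "\<mu> = (\<lambda>t. \<nu> t + \<epsilon> * \<phi> t)"
    have cont_\<mu>: "continuous_on UNIV \<mu>" unfolding \<mu>_def by (intro continuous_intros cont)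
    have \<mu>: "1 / 4 \<le> \<mu> t \<and> \<mu> t \<le> 3" if "t \<in> {-1..1}" for t using \<nu>\<phi>[OF that] by (simp add: \<mu>_def)
    have quarter: "(1 / 4 :: real) > 0" by simp
    have gauges: "norm_like (revolve e \<mu>) (1 / 4) 3" "norm_like (revolve e \<nu>) (1 / 4) 3"
      using revolve_bounds[OF e cont_\<mu> quarter \<mu>] revolve_bounds[OF e cont(1) quarter \<nu>]
      by (unfold_locales; simp add: revolve_scaleR)+
    have volume: "measure lborel {z. revolve e \<nu> z \<le> 1} < measure lborel {z. revolve e \<mu> z \<le> 1}"
    proof -
      let ?I = "\<lambda>v. \<phi> (slope v) / \<nu> (slope v) ^ (?m + 2) / hyp v ^ (?m + 1)"
      have \<nu>_pos: "\<nu> (slope v) > 0" for v using \<nu>[OF slope_in[of v]] by linarith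
      have \<mu>_pos: "\<mu> (slope v) > 0" for v using \<mu>[OF slope_in[of v]] by linarith
      \<comment> \<open>A non-integrable function has Bochner integral 0, so a negative integral
        implies integrability.\<close>
      have int: "integrable lborel ?I"
        using vol not_integrable_integral_eq by fastforce
      have intL: "integrable lborel (\<lambda>v. 1 / (hyp v * \<nu> (slope v)) ^ ?n)"
        and volL: "measure lborel {z. revolve e \<nu> z \<le> 1} = cyl_const TYPE('b) * (\<integral>v. 1 / (hyp v * \<nu> (slope v)) ^ ?n \<partial>lborel)"
        by (rule measure_revolve_le_1[where 'b = 'b, OF e assms(3) cont(1) quarter \<nu>]; assumption)+
      have intK: "integrable lborel (\<lambda>v. 1 / (hyp v * \<mu> (slope v)) ^ ?n)"
        and volK: "measure lborel {z. revolve e \<mu> z \<le> 1} = cyl_const TYPE('b) * (\<integral>v. 1 / (hyp v * \<mu> (slope v)) ^ ?n \<partial>lborel)"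
        by (rule measure_revolve_le_1[where 'b = 'b, OF e assms(3) cont_\<mu> quarter \<mu>]; assumption)+
      have "(\<integral>v. 1 / (hyp v * \<nu> (slope v)) ^ ?n - real ?n * \<epsilon> * ?I v \<partial>lborel) \<le>
          (\<integral>v. 1 / (hyp v * \<mu> (slope v)) ^ ?n \<partial>lborel)"
      proof (rule integral_mono)
        fix v :: real
        \<comment> \<open>Tangent at the profile of L. As \<nu> - \<mu> = - \<epsilon> \<phi>, its
          linear term integrates to a positive multiple of minus the integral of \<open>?I\<close>,
          which is a gain in volume for K.\<close>
        have "1 / \<nu> (slope v) ^ ?n + real ?n * (\<nu> (slope v) - \<mu> (slope v)) / \<nu> (slope v) ^ (?n + 1) \<le> 1 / \<mu> (slope v) ^ ?n"
          by (rule inverse_power_tangent[OF \<mu>_pos \<nu>_pos])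
        then have "(1 / \<nu> (slope v) ^ ?n + real ?n * (\<nu> (slope v) - \<mu> (slope v)) / \<nu> (slope v) ^ (?n + 1)) / hyp v ^ ?n \<le>
            1 / \<mu> (slope v) ^ ?n / hyp v ^ ?n"
          using hyp_pos[of v] by (intro divide_right_mono) auto
        moreover have "(1 / \<nu> (slope v) ^ ?n + real ?n * (\<nu> (slope v) - \<mu> (slope v)) / \<nu> (slope v) ^ (?n + 1)) / hyp v ^ ?n
            = 1 / (hyp v * \<nu> (slope v)) ^ ?n - real ?n * \<epsilon> * ?I v"
          by (simp add: \<mu>_def n power_mult_distrib add_divide_distrib diff_divide_distrib mult_ac)
        ultimately show "1 / (hyp v * \<nu> (slope v)) ^ ?n - real ?n * \<epsilon> * ?I v \<le> 1 / (hyp v * \<mu> (slope v)) ^ ?n"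
          by (simp add: power_mult_distrib mult.commute)
      qed (rule Bochner_Integration.integrable_diff[OF intL integrable_mult_right[OF int]], rule intK)
      moreover have "(\<integral>v. 1 / (hyp v * \<nu> (slope v)) ^ ?n - real ?n * \<epsilon> * ?I v \<partial>lborel) =
          (\<integral>v. 1 / (hyp v * \<nu> (slope v)) ^ ?n \<partial>lborel) - real ?n * \<epsilon> * (\<integral>v. ?I v \<partial>lborel)"
        by (simp only: Bochner_Integration.integral_diff[OF intL integrable_mult_right[OF int]] integral_mult_right_zero)
      moreover have "real ?n * \<epsilon> * (\<integral>v. ?I v \<partial>lborel) < 0"
        using vol \<open>\<epsilon> > 0\<close> by (intro mult_pos_neg) auto
      ultimately have "(\<integral>v. 1 / (hyp v * \<nu> (slope v)) ^ ?n \<partial>lborel) < (\<integral>v. 1 / (hyp v * \<mu> (slope v)) ^ ?n \<partial>lborel)"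
        by linarith
      then show ?thesis
        using cyl_const_pos[where 'b = 'b]
        by (simp add: volL volK)
    qed
    define V where "V = measure lborel (cball (0::'b) 1)"
    have "V > 0" by (simp add: V_def content_cball)
    \<comment> \<open>The gap comes entirely from the constant c, because the integral of the
      quartic is zero for sections through the axis.\<close>
    define \<kappa> where "\<kappa> = real ?m * \<epsilon> * (c * V)"
    have "\<kappa> > 0" unfolding \<kappa>_def using \<open>V > 0\<close> \<open>\<epsilon> > 0\<close> \<open>c > 0\<close> by simp
    have sections: "measure lborel {t. revolve e \<mu> (f t) \<le> 1} + \<kappa> \<le> measure lborel {t. revolve e \<nu> (f t) \<le> 1}"
      if f: "linear f" "\<And>t. norm (f t) = norm t" for f :: "'b \<Rightarrow> 'a"
    proof -
      \<comment> \<open>The orthogonal projection of the axis onto the range of f, read in the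
        coordinates of the section.\<close>
      define w where "w = adjoint f e"
      have w: "f t \<bullet> e = t \<bullet> w" for t unfolding w_def by (simp add: adjoint_works[OF f(1)])
      have \<tau>: "(t \<bullet> w) / norm t \<in> {-1..1}" for t
        using inner_div_norm_in_interval[OF e, of "f t"] by (simp add: f w)
      let ?\<tau> = "\<lambda>t. (t \<bullet> w) / norm t" and ?I = "\<lambda>t. indicator (cball (0::'b) 1) t :: real"
      have \<nu>_pos: "\<nu> (?\<tau> t) > 0" for t using \<nu>[OF \<tau>[of t]] by linarith
      have \<mu>_pos: "\<mu> (?\<tau> t) > 0" for t using \<mu>[OF \<tau>[of t]] by linarith
      have sectL: "integrable lborel (\<lambda>t. 1 / \<nu> (?\<tau> t) ^ ?m * ?I t)"
          "measure lborel {t. revolve e \<nu> (f t) \<le> 1} = (\<integral>t. 1 / \<nu> (?\<tau> t) ^ ?m * ?I t \<partial>lborel)"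
        by (rule measure_section_revolve_le_1[OF e f w cont(1) quarter \<nu>]; assumption)+
      have sectK: "integrable lborel (\<lambda>t. 1 / \<mu> (?\<tau> t) ^ ?m * ?I t)"
          "measure lborel {t. revolve e \<mu> (f t) \<le> 1} = (\<integral>t. 1 / \<mu> (?\<tau> t) ^ ?m * ?I t \<partial>lborel)"
        by (rule measure_section_revolve_le_1[OF e f w cont_\<mu> quarter \<mu>]; assumption)+
      have int0: "integrable lborel ?I" using integrable_ball_moment[where w = w and k = 0] by simp
      have integral_I: "(\<integral>t. ?I t \<partial>lborel) = measure lborel (cball (0::'b) 1)" by simp
      have intq: "integrable lborel (\<lambda>t. quartic ?m (?\<tau> t) * ?I t)"
      proof -
        have "integrable lborel (\<lambda>t. ?I t - 2 * real ?m * ((?\<tau> t)\<^sup>2 * ?I t) + real ?m * (real ?m + 2) / 3 * (?\<tau> t ^ 4 * ?I t))"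
          by (intro Bochner_Integration.integrable_add Bochner_Integration.integrable_diff integrable_mult_right integrable_ball_moment int0)
        then show ?thesis by (simp add: quartic_def algebra_simps)
      qed
      have "0 \<le> V * (1 - (norm w)\<^sup>2)\<^sup>2" using \<open>V > 0\<close> by simp
      also have "\<dots> = (\<integral>t. quartic ?m (?\<tau> t) * ?I t \<partial>lborel)"
        using ball_integral_quartic[of w] by (simp add: V_def quartic_def)
      finally have quartic_nonneg: "0 \<le> (\<integral>t. quartic ?m (?\<tau> t) * ?I t \<partial>lborel)" .
      have "(\<integral>t. 1 / \<mu> (?\<tau> t) ^ ?m * ?I t + real ?m * \<epsilon> * (quartic ?m (?\<tau> t) * ?I t + c * ?I t) \<partial>lborel) \<le>
          (\<integral>t. 1 / \<nu> (?\<tau> t) ^ ?m * ?I t \<partial>lborel)"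
      proof (rule integral_mono)
        fix t
        \<comment> \<open>Here the tangent is taken at the profile of K, so that the linear term
          increases the sections of L by at least a multiple of the quartic plus c.\<close>
        have "1 / \<mu> (?\<tau> t) ^ ?m + real ?m * \<epsilon> * (quartic ?m (?\<tau> t) + c) \<le>
            1 / \<mu> (?\<tau> t) ^ ?m + real ?m * \<epsilon> * (\<phi> (?\<tau> t) / \<mu> (?\<tau> t) ^ (?m + 1))"
          using sect[OF \<tau>[of t]] \<open>\<epsilon> > 0\<close> unfolding \<mu>_def by (intro add_left_mono mult_left_mono) auto
        also have "\<dots> = 1 / \<mu> (?\<tau> t) ^ ?m + real ?m * (\<mu> (?\<tau> t) - \<nu> (?\<tau> t)) / \<mu> (?\<tau> t) ^ (?m + 1)"
          by (simp add: \<mu>_def)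
        also have "\<dots> \<le> 1 / \<nu> (?\<tau> t) ^ ?m"
          by (rule inverse_power_tangent[OF \<nu>_pos \<mu>_pos])
        finally have "(1 / \<mu> (?\<tau> t) ^ ?m + real ?m * \<epsilon> * (quartic ?m (?\<tau> t) + c)) * ?I t \<le> 1 / \<nu> (?\<tau> t) ^ ?m * ?I t"
          by (intro mult_right_mono) auto
        then show "1 / \<mu> (?\<tau> t) ^ ?m * ?I t + real ?m * \<epsilon> * (quartic ?m (?\<tau> t) * ?I t + c * ?I t) \<le> 1 / \<nu> (?\<tau> t) ^ ?m * ?I t"
          by (simp add: algebra_simps)
      qed (intro Bochner_Integration.integrable_add integrable_mult_right intq int0 sectL(1) sectK(1))+
      also have "(\<integral>t. 1 / \<mu> (?\<tau> t) ^ ?m * ?I t + real ?m * \<epsilon> * (quartic ?m (?\<tau> t) * ?I t + c * ?I t) \<partial>lborel) =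
          measure lborel {t. revolve e \<mu> (f t) \<le> 1} + real ?m * \<epsilon> * ((\<integral>t. quartic ?m (?\<tau> t) * ?I t \<partial>lborel) + c * V)"
        unfolding sectK(2)
        unfolding V_def
        by (simp only: Bochner_Integration.integral_add[OF sectK(1) integrable_mult_right[OF
              Bochner_Integration.integrable_add[OF intq integrable_mult_right[OF int0]]]]
            Bochner_Integration.integral_add[OF intq integrable_mult_right[OF int0]]
            integral_mult_right_zero integral_I)
      also have "(\<integral>t. 1 / \<nu> (?\<tau> t) ^ ?m * ?I t \<partial>lborel) = measure lborel {t. revolve e \<nu> (f t) \<le> 1}"
        by (rule sectL(2)[symmetric])
      finally have "measure lborel {t. revolve e \<mu> (f t) \<le> 1} + real ?m * \<epsilon> * ((\<integral>t. quartic ?m (?\<tau> t) * ?I t \<partial>lborel) + c * V)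
          \<le> measure lborel {t. revolve e \<nu> (f t) \<le> 1}" .
      moreover have "\<kappa> \<le> real ?m * \<epsilon> * ((\<integral>t. quartic ?m (?\<tau> t) * ?I t \<partial>lborel) + c * V)"
        unfolding \<kappa>_def using quartic_nonneg \<open>\<epsilon> > 0\<close> by (intro mult_left_mono) auto
      ultimately show ?thesis by linarith
    qed
    show ?thesis
    proof (rule euclidean_counterexample_imp_curved[OF assms(1) gauges _ convex(1) _ _ volume \<open>\<kappa> > 0\<close> sections])
      show "convex_on UNIV (revolve e \<mu>)" using convex(2) by (simp add: \<mu>_def[abs_def])
      show "revolve e \<mu> (- x) = revolve e \<mu> x" "revolve e \<nu> (- x) = revolve e \<nu> x" for x
        by (rule revolve_minus; simp add: \<mu>_def even)+
    qed
  qed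
qed

end
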